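(* Let $G$ be a finite abelian group of order $v$ and suppose there exists a $(v,m,k,\lambda)$-SEDF in $G$ with $m\geq 3$. Let $d>2$ be an integer with $d\mid \exp(G)$, and let $t$ be the number of distinct prime divisors of $d$. Let $\lambda'$ be a divisor of $\lambda$ such that $\lambda'$ is self-conjugate modulo $d$ and $\gcd(\lambda',d)=1$. Then there exists a divisor $c$ of $\lambda'$ such that $$\sqrt{\lambda'}\leq c\leq 2^{t-1}\frac{v}{d}.$$
   Context: Let $G$ be a finite abelian group of order $v$ (written multiplicatively) with identity $e$. For positive integers $m,k,\lambda$, a $(v,m,k,\lambda)$-SEDF (strong external difference family) in $G$ is a collection $\{D_1,\dots,D_m\}$ of pairwise disjoint $k$-subsets of $G$ such that for each $j\in\{1,\dots,m\}$ the multiset $\{xy^{-1}: x\in D_\ell,\ y\in D_j,\ \ell\neq j\}$ contains every non-identity element of $G$ exactly $\lambda$ times and does not contain $e$. $\exp(G)$ is the least common multiple of the orders of the elements of $G$. Self-conjugacy: for a prime $p$ and positive integer $w$, write $w=p^s u$ with $\gcd(u,p)=1$; $p$ is self-conjugate modulo $w$ if there is an integer $r$ with $p^r\equiv -1\pmod u$. An integer $n$ is self-conjugate modulo $w$ if all of its prime divisors are self-conjugate modulo $w$. *)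

theory Defs
  imports Complex_Main "HOL-Library.Multiset" "HOL-Number_Theory.Cong"
    "HOL-Algebra.Multiplicative_Group"
begin

definition group_exponent :: "('a, 'b) monoid_scheme \<Rightarrow> nat" where
  "group_exponent G = Lcm (group.ord G ` carrier G)"

text \<open>The triples \<open>(l, x, y)\<close> carry the index \<open>l\<close> so that differences are counted with
  multiplicity.\<close>

definition ext_differences ::
    "('a, 'b) monoid_scheme \<Rightarrow> nat \<Rightarrow> (nat \<Rightarrow> 'a set) \<Rightarrow> nat \<Rightarrow> 'a multiset" where
  "ext_differences G m D j =
     image_mset (\<lambda>(l, x, y). x \<otimes>\<^bsub>G\<^esub> inv\<^bsub>G\<^esub> y)
       (mset_set {(l, x, y). l \<in> {1..m} \<and> l \<noteq> j \<and> x \<in> D l \<and> y \<in> D j})"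

text \<open>Only the values \<open>D 1, \<dots>, D m\<close> are relevant. The predicate is meant for a finite abelian
  group \<open>G\<close>; this is not part of the definition.\<close>

definition is_SEDF ::
    "('a, 'b) monoid_scheme \<Rightarrow> nat \<Rightarrow> nat \<Rightarrow> nat \<Rightarrow> nat \<Rightarrow> (nat \<Rightarrow> 'a set) \<Rightarrow> bool" where
  "is_SEDF G v m k lam D \<longleftrightarrow>
     Coset.order G = v \<and> 0 < m \<and> 0 < k \<and> 0 < lam \<and>
     (\<forall>j\<in>{1..m}. D j \<subseteq> carrier G \<and> card (D j) = k) \<and>
     (\<forall>i\<in>{1..m}. \<forall>j\<in>{1..m}. i \<noteq> j \<longrightarrow> D i \<inter> D j = {}) \<and>
     (\<forall>j\<in>{1..m}.
        (\<forall>g\<in>carrier G. g \<noteq> \<one>\<^bsub>G\<^esub> \<longrightarrow> count (ext_differences G m D j) g = lam) \<and>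
        \<one>\<^bsub>G\<^esub> \<notin># ext_differences G m D j)"

text \<open>For \<open>w > 0\<close> the factorisation \<open>w = p ^ s * u\<close> is unique. Since \<open>p\<close> is invertible modulo \<open>u\<close>
  and hence of finite order, natural exponents \<open>r\<close> cover all integer ones.\<close>

definition self_conjugate_prime :: "nat \<Rightarrow> nat \<Rightarrow> bool" where
  "self_conjugate_prime p w \<longleftrightarrow>
     (\<exists>s u. w = p ^ s * u \<and> coprime u p \<and> (\<exists>r::nat. [int p ^ r = - 1] (mod int u)))"

definition self_conjugate :: "nat \<Rightarrow> nat \<Rightarrow> bool" where
  "self_conjugate n w \<longleftrightarrow> (\<forall>p\<in>prime_factors n. self_conjugate_prime p w)"

end

(* Let chi be a character of G whose image is the group of d-th roots of unity, z a primitive one,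
   and put x = chi(D_1), y = chi(D_2 + ... + D_m). The SEDF property gives cnj x * y = -lam, and since
   m >= 3 the norms of x and y are rational, hence integers. For a prime p that is self-conjugate
   modulo d, complex conjugation is a power of Frobenius modulo p, so p divides x in Z[z] as soon
   as it divides |x|^2. Splitting off the primes of lam' one by one yields lam' = c1 * c2 with c1 | x
   and c2 | y, and c is the larger of c1 and c2.

   It remains to bound an integer c coprime to d that divides a nonzero character sum chi(A). Let
   f k be the number of a in A with chi a = z^k, so that 0 <= f <= v/d. Applying the difference
   operators with steps d/p, p | d prime, gives a function h with |h| <= 2^(t-1) v/d whose Fourier
   coefficients vanish except at primitive roots, where they are divisible by c because the one at
   z is and the conjugates of z satisfy the same integral relations. By Fourier inversion c divides
   every value of h, and h is not 0. *)
theory Submission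
  imports Defs "Jordan_Normal_Form.Char_Poly" "HOL-Computational_Algebra.Primes"
begin

section \<open>Integral combinations of powers of a root of unity\<close>

text \<open>Elements of Z[z] are represented by integer polynomials, so that a relation found at
  \<open>z\<close> can be evaluated at other roots of unity; this plays the role of Galois
  automorphisms.\<close>

definition int_eval :: "int poly \<Rightarrow> complex \<Rightarrow> complex" where
  "int_eval F z = poly (map_poly of_int F) z"

lemma int_eval_0 [simp]: "int_eval 0 z = 0"
  and int_eval_1 [simp]: "int_eval 1 z = 1"
  and int_eval_pCons [simp]: "int_eval (pCons a F) z = of_int a + z * int_eval F z"
  and int_eval_add [simp]: "int_eval (F + H) z = int_eval F z + int_eval H z"
  and int_eval_diff [simp]: "int_eval (F - H) z = int_eval F z - int_eval H z"
  and int_eval_uminus [simp]: "int_eval (- F) z = - int_eval F z"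
  and int_eval_mult [simp]: "int_eval (F * H) z = int_eval F z * int_eval H z"
  by (simp_all add: int_eval_def of_int_hom.map_poly_pCons_hom hom_distribs)

lemma int_eval_power [simp]: "int_eval (F ^ n) z = int_eval F z ^ n"
  by (induction n) simp_all

lemma int_eval_of_nat [simp]: "int_eval (of_nat n) z = of_nat n"
  by (induction n) simp_all

lemma int_eval_monom [simp]: "int_eval (monom c n) z = of_int c * z ^ n"
  by (induction n) (simp_all add: monom_0 monom_Suc)

lemma int_eval_pcompose: "int_eval (pcompose F H) z = int_eval F (int_eval H z)"
  by (induction F) (simp_all add: pcompose_pCons)

lemma int_eval_altdef: "int_eval F z = (\<Sum>k\<le>degree F. of_int (coeff F k) * z ^ k)"
  by (simp add: int_eval_def poly_altdef)

lemma cnj_int_eval: "cnj (int_eval F z) = int_eval F (cnj z)"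
  by (induction F) simp_all

lemma root_of_unity_power_cong:
  assumes "z ^ d = 1" "[m = n] (mod d)"
  shows "z ^ m = (z::complex) ^ n"
proof -
  have "z ^ k = z ^ (k mod d)" for k
  proof -
    have "z ^ k = z ^ (d * (k div d) + k mod d)" by simp
    also have "\<dots> = z ^ (k mod d)"
      using assms(1) by (simp only: power_add power_mult) simp
    finally show ?thesis .
  qed
  then show ?thesis using assms(2) unfolding cong_def by metis
qed

section \<open>The ring Z[z]\<close>

definition int_adjoin :: "complex \<Rightarrow> complex set" where
  "int_adjoin z = range (\<lambda>F. int_eval F z)"

lemma int_adjoin_iff: "x \<in> int_adjoin z \<longleftrightarrow> (\<exists>F. x = int_eval F z)"
  by (auto simp: int_adjoin_def)

lemma int_eval_in_int_adjoin [simp]: "int_eval F z \<in> int_adjoin z"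
  by (simp add: int_adjoin_def)

lemma int_adjoin_add: "x \<in> int_adjoin z \<Longrightarrow> y \<in> int_adjoin z \<Longrightarrow> x + y \<in> int_adjoin z"
  and int_adjoin_diff: "x \<in> int_adjoin z \<Longrightarrow> y \<in> int_adjoin z \<Longrightarrow> x - y \<in> int_adjoin z"
  and int_adjoin_mult: "x \<in> int_adjoin z \<Longrightarrow> y \<in> int_adjoin z \<Longrightarrow> x * y \<in> int_adjoin z"
  unfolding int_adjoin_iff
  by (metis int_eval_add, metis int_eval_diff, metis int_eval_mult)

lemma int_adjoin_of_int [simp]: "of_int n \<in> int_adjoin z"
proof -
  have "of_int n = int_eval [:n:] z" by simp
  then show ?thesis unfolding int_adjoin_iff by blast
qed

lemma int_adjoin_of_nat [simp]: "of_nat n \<in> int_adjoin z"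
  using int_adjoin_of_int[of "int n"] by simp

lemma int_adjoin_power_self [simp]: "z ^ k \<in> int_adjoin z"
proof -
  have "z ^ k = int_eval (monom 1 k) z" by simp
  then show ?thesis unfolding int_adjoin_iff by blast
qed

lemma int_adjoin_sum: "(\<And>i. i \<in> I \<Longrightarrow> f i \<in> int_adjoin z) \<Longrightarrow> sum f I \<in> int_adjoin z"
  using int_adjoin_of_int[of 0 z]
  by (induction I rule: infinite_finite_induct) (auto intro: int_adjoin_add)

lemma int_adjoin_power: "x \<in> int_adjoin z \<Longrightarrow> x ^ n \<in> int_adjoin z"
  unfolding int_adjoin_iff by (metis int_eval_power)

text \<open>Conjugation inverts \<open>z\<close>, and the inverse is \<open>z ^ (d - 1)\<close>;
  substituting \<open>X ^ (d - 1)\<close> into a polynomial for \<open>x\<close> gives one for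
  \<open>cnj x\<close>.\<close>

lemma int_adjoin_cnj:
  assumes "z ^ d = 1" "d > 0" "x \<in> int_adjoin z"
  shows "cnj x \<in> int_adjoin z"
proof -
  obtain F where F: "x = int_eval F z" using assms(3) by (auto simp: int_adjoin_iff)
  have "norm z = 1" using assms(1,2) by (metis norm_one norm_power power_eq_1_iff neq0_conv norm_ge_zero)
  then have "z * cnj z = 1" by (simp add: complex_norm_square[symmetric])
  moreover have "z * z ^ (d - 1) = 1" using assms(1,2) by (simp flip: power_Suc)
  ultimately have "cnj z = z ^ (d - 1)" by (metis mult.assoc mult.commute mult_1)
  then have "cnj x = int_eval (pcompose F (monom 1 (d - 1))) z"
    by (simp add: F cnj_int_eval int_eval_pcompose)
  then show ?thesis unfolding int_adjoin_iff by blast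
qed

text \<open>Multiplication by an element of \<open>\<int>[z]\<close> acts on the vector of powers of \<open>z\<close> by an integer
  matrix, whose characteristic polynomial annihilates the element.\<close>

lemma algebraic_int_int_adjoin:
  assumes "z ^ d = 1" "d > 0" "x \<in> int_adjoin z"
  shows "algebraic_int x"
proof -
  obtain F where F: "x = int_eval F z" using assms(3) by (auto simp: int_adjoin_iff)
  \<comment> \<open>Row \<open>i\<close> expresses \<open>x * z ^ i\<close> by the powers
    \<open>z ^ j\<close> with \<open>j < d\<close>, exponents being reduced modulo
    \<open>d\<close>.\<close>
  define M :: "int mat" where
    "M = mat d d (\<lambda>(i, j). \<Sum>k\<le>degree F. if (i + k) mod d = j then coeff F k else 0)"
  have M: "M \<in> carrier_mat d d" by (simp add: M_def)
  let ?M = "map_mat complex_of_int M"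
  let ?v = "vec d (\<lambda>i. z ^ i)"
  have "?M *\<^sub>v ?v = x \<cdot>\<^sub>v ?v"
  proof (rule eq_vecI)
    fix i assume "i < dim_vec (x \<cdot>\<^sub>v ?v)"
    then have i: "i < d" by simp
    have "(?M *\<^sub>v ?v) $ i = (\<Sum>j<d. of_int (M $$ (i, j)) * z ^ j)"
      using i M by (simp add: scalar_prod_def atLeast0LessThan)
    also have "\<dots> = (\<Sum>j<d. \<Sum>k\<le>degree F. if (i + k) mod d = j then of_int (coeff F k) * z ^ j else 0)"
      using i by (intro sum.cong) (auto simp: M_def sum_distrib_right intro!: sum.cong)
    also have "\<dots> = (\<Sum>k\<le>degree F. \<Sum>j<d. if (i + k) mod d = j then of_int (coeff F k) * z ^ j else 0)"
      by (rule sum.swap)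
    also have "\<dots> = (\<Sum>k\<le>degree F. of_int (coeff F k) * z ^ ((i + k) mod d))"
      using assms(2) by (intro sum.cong) (auto simp: sum.delta')
    also have "\<dots> = (\<Sum>k\<le>degree F. z ^ i * (of_int (coeff F k) * z ^ k))"
    proof (intro sum.cong refl)
      fix k
      have "z ^ ((i + k) mod d) = z ^ (i + k)"
        using assms(1) by (rule root_of_unity_power_cong) (simp add: cong_def)
      then show "of_int (coeff F k) * z ^ ((i + k) mod d) = z ^ i * (of_int (coeff F k) * z ^ k)"
        by (simp add: power_add)
    qed
    also have "\<dots> = (x \<cdot>\<^sub>v ?v) $ i"
      using i by (simp add: F int_eval_altdef sum_distrib_left[symmetric] mult.commute)
    finally show "(?M *\<^sub>v ?v) $ i = (x \<cdot>\<^sub>v ?v) $ i" .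
  qed (use M in auto)
  moreover have "?v \<noteq> 0\<^sub>v d"
  proof
    assume "?v = 0\<^sub>v d"
    then have "?v $ 0 = 0\<^sub>v d $ 0" by simp
    then show False using assms(2) by simp
  qed
  ultimately have "eigenvalue ?M x"
    using M unfolding eigenvalue_def eigenvector_def by (intro exI[of _ ?v]) auto
  then have "poly (char_poly ?M) x = 0"
    using eigenvalue_root_char_poly[of ?M d x] M by auto
  then have "poly (map_poly of_int (char_poly M)) x = 0"
    using M by (simp add: of_int_hom.char_poly_hom)
  moreover have "lead_coeff (char_poly M) = 1"
    using degree_monic_char_poly[OF M] by simp
  ultimately show ?thesis by (auto simp: algebraic_int_altdef_ipoly)
qed

section \<open>Divisibility of integers in Z[z]\<close>

lemma int_adjoin_rational:
  assumes "z ^ d = 1" "d > 0" "x \<in> int_adjoin z" "x \<in> \<rat>"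
  shows "x \<in> \<int>"
  using rational_algebraic_int_is_int[OF algebraic_int_int_adjoin[OF assms(1-3)] assms(4)] .

text \<open>The quotient \<open>a / b\<close> is rational and an algebraic integer, so divisibility
  in Z[z] descends to the integers. For \<open>b = 0\<close> the equation gives
  \<open>a = 0\<close>.\<close>

lemma int_adjoin_of_int_dvd:
  assumes "z ^ d = 1" "d > 0" "of_int a = of_int b * x" "x \<in> int_adjoin z"
  shows "b dvd a"
proof (cases "b = 0")
  case False
  then have "x = of_int a / of_int b" using assms(3) by (simp add: field_simps)
  then have "x \<in> \<rat>" by simp
  with assms obtain c where "x = of_int c" by (metis int_adjoin_rational Ints_cases)
  then have "(of_int a :: complex) = of_int (b * c)" using assms(3) by simp
  then have "a = b * c" by (simp only: of_int_eq_iff)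
  then show ?thesis by simp
qed (use assms in simp)

text \<open>Cancelling powers of \<open>x\<close> makes the constant term of \<open>q\<close>
  nonzero; the equation \<open>q(x) = 0\<close> then exhibits this term as a multiple of
  \<open>x\<close>.\<close>

lemma int_poly_root_dvd_int:
  assumes "int_eval q x = 0" "q \<noteq> 0" "x \<noteq> 0"
  shows "\<exists>c r. c \<noteq> 0 \<and> of_int c = x * int_eval r x"
  using assms
proof (induction q)
  case (pCons a q)
  show ?case
  proof (cases "a = 0")
    case True
    then show ?thesis using pCons by auto
  next
    case False
    have "of_int a = x * int_eval (- q) x"
      using pCons.prems by (simp add: add_eq_0_iff2)
    then show ?thesis using False by blast
  qed
qed simp

text \<open>A nonzero integer \<open>c\<close> that is a multiple of \<open>x\<close> in Z[z] acts
  as a norm: every natural number dividing \<open>x\<close> divides \<open>c\<close>.\<close>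

lemma int_adjoin_nonzero_bound:
  assumes "z ^ d = 1" "d > 0" "x \<in> int_adjoin z" "x \<noteq> 0"
  shows "\<exists>N>0. \<forall>p::nat. \<forall>y\<in>int_adjoin z. x = of_nat p * y \<longrightarrow> p \<le> N"
proof -
  obtain q where "lead_coeff q = 1" "int_eval q x = 0"
    using algebraic_int_int_adjoin[OF assms(1-3)]
    by (auto simp: algebraic_int_altdef_ipoly int_eval_def)
  then obtain c r where c: "c \<noteq> 0" "of_int c = x * int_eval r x"
    using int_poly_root_dvd_int[of q x] assms(4) by (metis leading_coeff_0_iff zero_neq_one)
  obtain F where F: "x = int_eval F z" using assms(3) by (auto simp: int_adjoin_iff)
  have r: "int_eval r x \<in> int_adjoin z"
    by (metis F int_eval_pcompose int_eval_in_int_adjoin)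
  show ?thesis
  proof (intro exI[of _ "nat \<bar>c\<bar>"] conjI allI ballI impI)
    fix p y assume y: "y \<in> int_adjoin z" "x = of_nat p * y"
    then have "of_int c = of_int (int p) * (y * int_eval r x)" using c by (simp add: mult.assoc)
    then have "int p dvd c"
      using y r assms(1,2) by (blast intro: int_adjoin_of_int_dvd int_adjoin_mult)
    then have "int p \<le> \<bar>c\<bar>" using dvd_imp_le_int[OF c(1)] by fastforce
    then show "p \<le> nat \<bar>c\<bar>" by simp
  qed (use c in auto)
qed

section \<open>Frobenius congruences modulo a prime\<close>

lemma freshman_dvd:
  fixes a b :: "'a::comm_ring_1"
  assumes "prime p"
  shows "of_nat p dvd (a + b) ^ p - (a ^ p + b ^ p)"
proof -
  have p: "p > 0" using assms by (simp add: prime_gt_0_nat)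
  have "(a + b) ^ p = (\<Sum>k\<le>p. of_nat (p choose k) * a ^ k * b ^ (p - k))"
    by (rule binomial_ring)
  also have "{..p} = insert 0 (insert p {0<..<p})" using p by auto
  also have "(\<Sum>k\<in>\<dots>. of_nat (p choose k) * a ^ k * b ^ (p - k))
      = b ^ p + (a ^ p + (\<Sum>k\<in>{0<..<p}. of_nat (p choose k) * a ^ k * b ^ (p - k)))"
    using p by simp
  finally have "(a + b) ^ p - (a ^ p + b ^ p)
      = (\<Sum>k\<in>{0<..<p}. of_nat (p choose k) * a ^ k * b ^ (p - k))" by simp
  moreover have "of_nat p dvd of_nat (p choose k) * a ^ k * b ^ (p - k)" if "k \<in> {0<..<p}" for k
  proof -
    have "p dvd (p choose k)" using that assms by (intro dvd_choose_prime) auto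
    then have "(of_nat p :: 'a) dvd of_nat (p choose k)" by (auto elim!: dvdE)
    then show ?thesis by (simp add: mult.assoc)
  qed
  ultimately show ?thesis by (metis (no_types, lifting) dvd_sum)
qed

text \<open>Fermat's little theorem, applied below to the coefficients of polynomials. The binomial
  congruence gives the induction; reduction modulo \<open>p\<close> covers negative
  \<open>a\<close>.\<close>

lemma prime_dvd_power_diff_self:
  assumes "prime p"
  shows "int p dvd a ^ p - a"
proof -
  have nat_case: "int p dvd int n ^ p - int n" for n
  proof (induction n)
    case (Suc n)
    have "int p dvd (int n + 1) ^ p - (int n ^ p + 1 ^ p)"
      using freshman_dvd[OF assms, of "int n" 1] by simp
    then have "int p dvd ((int n + 1) ^ p - (int n ^ p + 1)) + (int n ^ p - int n)"
      using Suc by (intro dvd_add) simp_all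
    then show ?case by (simp add: algebra_simps)
  qed (use prime_gt_0_nat[OF assms] in \<open>simp add: power_0_left\<close>)
  have "[a ^ p = a] (mod int p)"
  proof -
    have "int p > 0" using assms by (simp add: prime_gt_0_nat)
    then have nn: "a mod int p = int (nat (a mod int p))" by simp
    have "[a ^ p = (a mod int p) ^ p] (mod int p)" by (simp add: cong_def power_mod)
    also have "[(a mod int p) ^ p = a mod int p] (mod int p)"
      using nat_case[of "nat (a mod int p)"] nn by (simp add: cong_iff_dvd_diff)
    also have "[a mod int p = a] (mod int p)" by (simp add: cong_def)
    finally show ?thesis .
  qed
  then show ?thesis by (simp add: cong_iff_dvd_diff)
qed

text \<open>The composition is \<open>F(X ^ p)\<close>. With \<open>pCons a F\<close> written as
  \<open>a + X * F\<close>, the binomial congruence separates the summands and Fermat's theorem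
  replaces \<open>a ^ p\<close> by \<open>a\<close>.\<close>

lemma int_poly_frobenius:
  assumes "prime p"
  shows "(of_nat p :: int poly) dvd F ^ p - pcompose F (monom 1 p)"
proof (induction F)
  case 0
  then show ?case using prime_gt_0_nat[OF assms] by (simp add: power_0_left)
next
  case (pCons a F)
  let ?P = "of_nat p :: int poly" and ?X = "[:0, 1:] :: int poly"
  have split: "pCons a F = [:a:] + ?X * F" by simp
  have "?P dvd [:a:] ^ p - [:a:]"
  proof -
    obtain c where "a ^ p - a = int p * c" using prime_dvd_power_diff_self[OF assms] by blast
    then have "[:a:] ^ p - [:a:] = ?P * [:c:]" by (simp add: poly_const_pow of_nat_poly)
    then show ?thesis by (rule dvdI)
  qed
  moreover have "?P dvd ?X ^ p * F ^ p - ?X ^ p * pcompose F (monom 1 p)"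
    using pCons.IH by (simp flip: right_diff_distrib)
  moreover have "?P dvd ([:a:] + ?X * F) ^ p - ([:a:] ^ p + (?X * F) ^ p)"
    using assms by (rule freshman_dvd)
  ultimately have "?P dvd (([:a:] + ?X * F) ^ p - ([:a:] ^ p + (?X * F) ^ p)) +
      (([:a:] ^ p - [:a:]) + (?X ^ p * F ^ p - ?X ^ p * pcompose F (monom 1 p)))"
    by (intro dvd_add)
  also have "\<dots> = ([:a:] + ?X * F) ^ p - ([:a:] + ?X ^ p * pcompose F (monom 1 p))"
    by (simp only: power_mult_distrib)
  also have "[:a:] + ?X ^ p * pcompose F (monom 1 p) = pcompose (pCons a F) (monom 1 p)"
    by (simp only: pcompose_pCons monom_altdef smult_1_left)
  finally show ?case by (simp only: split)
qed

lemma dvd_diff_power: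
  fixes a b :: "'a::comm_ring_1"
  assumes "c dvd a - b"
  shows "c dvd a ^ n - b ^ n"
proof (cases n)
  case (Suc m)
  then show ?thesis using assms power_diff_sumr2[of a n b] by (simp add: dvd_mult2)
qed simp

lemma int_poly_frobenius_power:
  assumes "prime p"
  shows "(of_nat p :: int poly) dvd F ^ (p ^ r) - pcompose F (monom 1 (p ^ r))"
proof (induction r)
  case 0
  have "monom 1 (Suc 0) = [:0, 1 :: int:]" by (simp add: monom_Suc monom_0)
  then show ?case by simp
next
  case (Suc r)
  let ?H = "pcompose F (monom 1 (p ^ r))"
  have "of_nat p dvd (F ^ (p ^ r)) ^ p - ?H ^ p"
    using Suc.IH by (rule dvd_diff_power)
  moreover have "of_nat p dvd ?H ^ p - pcompose ?H (monom 1 p)"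
    using assms by (rule int_poly_frobenius)
  ultimately have "of_nat p dvd ((F ^ (p ^ r)) ^ p - ?H ^ p) + (?H ^ p - pcompose ?H (monom 1 p))"
    by (rule dvd_add)
  moreover have "pcompose ?H (monom 1 p) = pcompose F (monom 1 (p ^ Suc r))"
    by (simp add: pcompose_assoc[symmetric] pcompose_hom.hom_power monom_altdef pcompose_pCons
        pcompose_smult power_mult mult.commute)
  ultimately show ?case by (simp add: mult.commute flip: power_mult)
qed

lemma int_eval_frobenius:
  assumes "prime p"
  obtains H where "int_eval F z ^ (p ^ r) = int_eval F (z ^ (p ^ r)) + of_nat p * int_eval H z"
proof -
  obtain H where "F ^ (p ^ r) - pcompose F (monom 1 (p ^ r)) = of_nat p * H"
    using int_poly_frobenius_power[OF assms] by blast
  then have "int_eval (F ^ (p ^ r) - pcompose F (monom 1 (p ^ r))) z = int_eval (of_nat p * H) z"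
    by simp
  then show ?thesis using that[of H] by (simp add: int_eval_pcompose algebra_simps)
qed

text \<open>If \<open>p ^ r = -1\<close> modulo \<open>d\<close>, Frobenius makes
  \<open>x ^ (p ^ r)\<close> congruent to \<open>cnj x\<close> and \<open>x ^ (p ^ (2 * r))\<close>
  congruent to \<open>x\<close> modulo \<open>p\<close>. The second power contains the factor
  \<open>x ^ (p ^ r + 1)\<close>, which is congruent to \<open>x * cnj x\<close> and hence to
  0.\<close>

lemma self_conjugate_prime_dvd:
  assumes z: "z ^ d = 1" "d > 2" and x: "x \<in> int_adjoin z"
    and p: "prime p" "self_conjugate_prime p d" "coprime p d"
    and norm: "x * cnj x = of_nat p * of_int k"
  shows "\<exists>y\<in>int_adjoin z. x = of_nat p * y"
proof -
  obtain s u r where su: "d = p ^ s * u" "coprime u p" "[int p ^ r = -1] (mod int u)"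
    using p(2) by (auto simp: self_conjugate_prime_def)
  have "s = 0"
    using p(1,3) su(1) not_prime_unit by (metis coprime_common_divisor dvd_refl dvd_triv_left
        dvd_power neq0_conv dvd_trans)
  then have r: "[int p ^ r = -1] (mod int d)" using su by simp
  have r': "int d dvd int (p ^ r + 1)" using r by (simp add: cong_iff_dvd_diff add.commute)
  then have dvd: "d dvd p ^ r + 1" by (simp only: int_dvd_int_iff)
  \<comment> \<open>Since \<open>d > 2\<close>, the residues 1 and -1 differ. A positive
    \<open>r\<close> makes \<open>p ^ r + 1 \<le> p ^ (2 * r)\<close>, so the subtraction in
    \<open>?e\<close> is not truncated.\<close>
  have "r \<noteq> 0"
  proof
    assume "r = 0"
    then have "d dvd 2" using dvd by (simp add: numeral_2_eq_2)
    then show False using z(2) by (auto dest: dvd_imp_le)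
  qed
  obtain F where F: "x = int_eval F z" using x by (auto simp: int_adjoin_iff)
  have z1: "z ^ (p ^ r) * z = 1"
    using root_of_unity_power_cong[OF z(1), of "p ^ r + 1" 0] dvd
    by (simp add: cong_0_iff mult.commute)
  have "norm z = 1"
    using z by (metis norm_one norm_power power_eq_1_iff norm_ge_zero not_less_zero)
  then have "z * cnj z = 1" by (simp add: complex_norm_square[symmetric])
  then have zc: "cnj z = z ^ (p ^ r)" using z1 by (metis mult.assoc mult.commute mult_1)
  have zz: "z ^ (p ^ (2 * r)) = z"
  proof -
    have "z ^ (p ^ (2 * r)) = (z ^ (p ^ r)) ^ (p ^ r)"
      by (simp add: power_mult[symmetric] mult_2 power_add)
    also have "\<dots> = cnj z ^ (p ^ r)" by (simp only: zc)
    also have "\<dots> = cnj (z ^ (p ^ r))" by simp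
    also have "\<dots> = cnj (cnj z)" by (simp only: zc)
    finally show ?thesis by simp
  qed
  obtain H where H: "x ^ (p ^ r) = cnj x + of_nat p * int_eval H z"
    using int_eval_frobenius[OF p(1), of F z r] by (metis F zc cnj_int_eval)
  obtain K where K: "x ^ (p ^ (2 * r)) = x + of_nat p * int_eval K z"
    using int_eval_frobenius[OF p(1), of F z "2 * r"] by (metis F zz)
  have le: "p ^ r + 1 \<le> p ^ (2 * r)"
  proof -
    have "p \<ge> 2" using p(1) by (rule prime_ge_2_nat)
    then have "p ^ r \<ge> 2" using \<open>r \<noteq> 0\<close> self_le_power[of p r] by simp
    then have "2 * p ^ r \<le> p ^ r * p ^ r" by simp
    then show ?thesis using \<open>p ^ r \<ge> 2\<close> by (simp add: mult_2 power_add)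
  qed
  let ?e = "p ^ (2 * r) - (p ^ r + 1)"
  let ?y = "(of_int k + x * int_eval H z) * x ^ ?e - int_eval K z"
  have "x ^ (p ^ r + 1) = of_nat p * (of_int k + x * int_eval H z)"
    using H norm by (simp add: algebra_simps)
  moreover have "x ^ (p ^ (2 * r)) = x ^ (p ^ r + 1) * x ^ ?e"
    using le by (simp only: power_add[symmetric] le_add_diff_inverse)
  ultimately have "x = of_nat p * ?y" using K by (simp add: algebra_simps)
  moreover have "?y \<in> int_adjoin z"
    using x by (intro int_adjoin_diff int_adjoin_mult int_adjoin_add int_adjoin_power) simp_all
  ultimately show ?thesis by blast
qed

section \<open>Transfer of relations to conjugate roots of unity\<close>

lemma prime_factors_avoiding_residue:
  fixes A d i :: nat
  assumes "coprime i d" "d > 0"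
  obtains n where "n > 0" "[n = i] (mod d)" "\<And>q. prime q \<Longrightarrow> q dvd n \<Longrightarrow> q > A"
proof -
  \<comment> \<open>A prime up to \<open>A\<close> divides exactly one of \<open>i\<close> and
    \<open>d * P\<close>, hence not the sum \<open>i + d * P\<close>, which serves as
    \<open>n\<close>.\<close>
  define P where "P = \<Prod>{q. prime q \<and> q \<le> A \<and> \<not> q dvd i}"
  have fin: "finite {q. prime q \<and> q \<le> A \<and> \<not> q dvd i}" by (rule finite_subset[of _ "{..A}"]) auto
  have "P > 0" unfolding P_def by (intro prod_pos) (auto simp: prime_gt_0_nat)
  moreover have "q > A" if q: "prime q" "q dvd i + d * P" for q
  proof (rule ccontr)
    assume "\<not> A < q"
    then have le: "q \<le> A" by simp
    show False
    proof (cases "q dvd i")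
      case True
      then have "q dvd d * P" using q(2) by (simp add: dvd_add_right_iff)
      moreover have "\<not> q dvd d" using True assms(1) q(1) by (metis coprime_common_divisor not_prime_unit)
      ultimately have "q dvd P" using q(1) by (simp add: prime_dvd_mult_iff)
      then obtain q' where "q' \<in> {q. prime q \<and> q \<le> A \<and> \<not> q dvd i}" "q dvd q'"
        unfolding P_def using prime_dvd_prod_iff[OF fin q(1), of "\<lambda>x. x"] by auto
      then show False using True q(1) by (metis (mono_tags) mem_Collect_eq primes_dvd_imp_eq)
    next
      case False
      then have "q dvd P" unfolding P_def using fin q(1) le by (intro dvd_prodI[where f = "\<lambda>x. x", simplified]) auto
      then show False using False q(2) by (simp add: dvd_add_left_iff)
    qed
  qed
  ultimately show ?thesis using that[of "i + d * P"] assms(2) by (simp add: cong_def)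
qed

text \<open>By Frobenius, \<open>F (z ^ p)\<close> lies in \<open>p \<int>[z]\<close>. A nonzero element of \<open>\<int>[z]\<close> is divisible by
  finitely many primes only, so \<open>F (z ^ p) = 0\<close> for large primes \<open>p\<close>.\<close>

lemma int_eval_root_power_large_prime:
  assumes "d > 0"
  obtains A where
    "\<And>p z. prime p \<Longrightarrow> p > A \<Longrightarrow> z ^ d = 1 \<Longrightarrow> int_eval F z = 0 \<Longrightarrow> int_eval F (z ^ p) = 0"
proof -
  define Z where "Z = {z::complex. z ^ d = 1}"
  have finZ: "finite Z" unfolding Z_def using assms by (intro finite_roots_unity) simp
  have "\<exists>N. z \<in> Z \<longrightarrow> int_eval F w \<in> int_adjoin z \<longrightarrow> int_eval F w \<noteq> 0 \<longrightarrow>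
      (\<forall>p::nat. \<forall>y\<in>int_adjoin z. int_eval F w = of_nat p * y \<longrightarrow> p \<le> N)" for z w
  proof (cases "z \<in> Z \<and> int_eval F w \<in> int_adjoin z \<and> int_eval F w \<noteq> 0")
    case True
    then show ?thesis using int_adjoin_nonzero_bound[of z d "int_eval F w"] assms unfolding Z_def by blast
  qed blast
  then have "\<exists>N. \<forall>v. fst v \<in> Z \<longrightarrow> int_eval F (snd v) \<in> int_adjoin (fst v) \<longrightarrow>
      int_eval F (snd v) \<noteq> 0 \<longrightarrow>
      (\<forall>p::nat. \<forall>y\<in>int_adjoin (fst v). int_eval F (snd v) = of_nat p * y \<longrightarrow> p \<le> N v)"
    by (intro choice) simp
  then obtain N where N: "\<forall>v. fst v \<in> Z \<longrightarrow> int_eval F (snd v) \<in> int_adjoin (fst v) \<longrightarrow>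
      int_eval F (snd v) \<noteq> 0 \<longrightarrow>
      (\<forall>p::nat. \<forall>y\<in>int_adjoin (fst v). int_eval F (snd v) = of_nat p * y \<longrightarrow> p \<le> N v)" ..
  \<comment> \<open>The primes \<open>p\<close> are unbounded, but \<open>z ^ p\<close> stays in the
    finite set \<open>Z\<close>; summing the bounds over all pairs gives a threshold independent of
    \<open>z\<close> and \<open>p\<close>.\<close>
  define A where "A = sum N (Z \<times> Z)"
  show ?thesis
  proof (rule that[of A], rule ccontr)
    fix p z assume p: "prime p" "p > A" and z: "z ^ d = 1" "int_eval F z = 0"
      and nz: "int_eval F (z ^ p) \<noteq> 0"
    obtain H where "int_eval F z ^ p = int_eval F (z ^ p) + of_nat p * int_eval H z"
      using int_eval_frobenius[OF p(1), of F z 1] by auto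
    then have eq: "int_eval F (z ^ p) = of_nat p * int_eval (- H) z"
      using z(2) p(1) prime_gt_0_nat[OF p(1)] by (simp add: power_0_left add_eq_0_iff2)
    have mem: "int_eval F (z ^ p) \<in> int_adjoin z"
      unfolding eq by (intro int_adjoin_mult int_adjoin_of_nat int_eval_in_int_adjoin)
    have zp: "(z ^ p) ^ d = 1" using z(1) by (metis mult.commute power_mult power_one)
    have "p \<le> N (z, z ^ p)"
    proof (rule N[rule_format, of "(z, z ^ p)" "int_eval (- H) z" p, unfolded fst_conv snd_conv])
      show "z \<in> Z" using z(1) by (simp add: Z_def)
    qed (fact mem nz int_eval_in_int_adjoin eq)+
    also have "\<dots> \<le> A"
      unfolding A_def using member_le_sum[of "(z, z ^ p)" "Z \<times> Z" N] finZ z(1) zp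
      by (simp add: Z_def)
    finally show False using p(2) by simp
  qed
qed

text \<open>The exponent is replaced by a congruent \<open>n\<close> all of whose prime factors are
  large, and the relation passes from \<open>w\<close> to \<open>w ^ p\<close> for one prime factor
  at a time.\<close>

lemma int_eval_root_coprime_power:
  assumes "z ^ d = 1" "d > 0" "coprime i d" "int_eval F z = 0"
  shows "int_eval F (z ^ i) = 0"
proof -
  obtain A where A: "\<And>p z. prime p \<Longrightarrow> p > A \<Longrightarrow> z ^ d = 1 \<Longrightarrow> int_eval F z = 0 \<Longrightarrow>
      int_eval F (z ^ p) = 0"
    using int_eval_root_power_large_prime[OF assms(2)] by blast
  obtain n where n: "n > 0" "[n = i] (mod d)" "\<And>q. prime q \<Longrightarrow> q dvd n \<Longrightarrow> q > A"
    using prime_factors_avoiding_residue[OF assms(3,2), of A] by blast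
  have "int_eval F (w ^ n) = 0" if "w ^ d = 1" "int_eval F w = 0" for w
    using n(1,3) that
  proof (induction n arbitrary: w rule: prime_divisors_induct)
    case (factor p n)
    then have "int_eval F (w ^ p) = 0" using A[of p w] by simp
    moreover have "(w ^ p) ^ d = 1" using factor.prems by (metis mult.commute power_mult power_one)
    ultimately have "int_eval F ((w ^ p) ^ n) = 0"
      using factor by (intro factor.IH) (auto simp: dvd_mult)
    then show ?case by (simp add: power_mult)
  qed (auto)
  then have "int_eval F (z ^ n) = 0" using assms by simp
  then show ?thesis using root_of_unity_power_cong[OF assms(1) n(2)] by simp
qed

text \<open>Divisibility by \<open>c\<close> is itself a polynomial relation, the vanishing of
  \<open>F - c * H\<close>.\<close>

lemma int_eval_dvd_coprime_power:
  assumes "z ^ d = 1" "d > 0" "coprime i d" "int_eval F z = of_nat c * int_eval H z"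
  shows "int_eval F (z ^ i) = of_nat c * int_eval H (z ^ i)"
  using int_eval_root_coprime_power[OF assms(1-3), of "F - of_nat c * H"] assms(4) by simp

section \<open>Characters of finite abelian groups\<close>

lemma prime_power_dvd_lcm:
  fixes x y :: nat
  assumes "prime p" "p ^ a dvd lcm x y" "x \<noteq> 0" "y \<noteq> 0"
  shows "p ^ a dvd x \<or> p ^ a dvd y"
proof -
  have "lcm x y \<noteq> 0" using assms by simp
  then have "a \<le> multiplicity p (lcm x y)"
    using assms(1,2) by (intro multiplicity_geI) auto
  also have "\<dots> = max (multiplicity p x) (multiplicity p y)"
    using assms by (intro multiplicity_lcm) auto
  finally show ?thesis using multiplicity_dvd' by (metis le_max_iff_disj)
qed

lemma prime_power_dvd_Lcm:
  fixes S :: "nat set"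
  assumes "finite S" "prime p" "p ^ a dvd Lcm S" "0 \<notin> S" "a > 0"
  shows "\<exists>s\<in>S. p ^ a dvd s"
  using assms(1,3,4)
proof (induction S)
  case empty
  then show ?case using assms(2,5) by (simp add: prime_nat_iff)
next
  case (insert x S)
  have "Lcm S \<noteq> 0" using insert by (simp add: Lcm_0_iff)
  then have "p ^ a dvd x \<or> p ^ a dvd Lcm S"
    using insert.prems assms(2) by (intro prime_power_dvd_lcm) auto
  then show ?case using insert by auto
qed

context comm_group
begin

lemma ord_mult_coprime:
  assumes "a \<in> carrier G" "b \<in> carrier G" "coprime (ord a) (ord b)"
  shows "ord (a \<otimes> b) = ord a * ord b"
proof -
  have aux: "ord x dvd ord (x \<otimes> y)" if "x \<in> carrier G" "y \<in> carrier G" "coprime (ord x) (ord y)" for x y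
  proof -
    \<comment> \<open>This exponent annihilates both \<open>x \<otimes> y\<close> and
      \<open>y\<close>, hence also \<open>x\<close>.\<close>
    let ?e = "ord (x \<otimes> y) * ord y"
    have "x [^] ?e = x [^] ?e \<otimes> y [^] ?e"
      using that by (simp add: pow_eq_id)
    also have "\<dots> = (x \<otimes> y) [^] ?e"
      using that by (simp add: pow_mult_distrib m_comm)
    also have "\<dots> = \<one>" using that by (subst pow_eq_id) auto
    finally have "ord x dvd ?e" using that pow_eq_id by blast
    then show ?thesis using that(3) by (simp add: coprime_dvd_mult_left_iff)
  qed
  have "ord a dvd ord (a \<otimes> b)" "ord b dvd ord (a \<otimes> b)"
    using aux[of a b] aux[of b a] assms by (simp_all add: m_comm coprime_commute)
  then have "ord a * ord b dvd ord (a \<otimes> b)" using assms(3) by (simp add: divides_mult)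
  then show ?thesis using abelian_ord_mul_divides[OF assms(1,2)] by (simp add: dvd_antisym)
qed

text \<open>The induction removes from \<open>d\<close> the full power \<open>p ^ a\<close> of a
  prime. That power divides the order of a single element, since a prime power dividing an lcm
  divides one of its arguments. A power of this element has order \<open>p ^ a\<close> and is
  multiplied by an element of the coprime order \<open>d'\<close>.\<close>

lemma ex_element_of_order:
  assumes fin: "finite (carrier G)" and "d dvd group_exponent G"
  shows "\<exists>g\<in>carrier G. ord g = d"
  using assms(2)
proof (induction d rule: less_induct)
  case (less d)
  have zero: "0 \<notin> ord ` carrier G"
    using ord_ge_1[OF fin] by fastforce
  then have "group_exponent G \<noteq> 0"
    unfolding group_exponent_def using fin by (simp add: Lcm_0_iff)
  then have d0: "d \<noteq> 0" using less.prems by auto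
  show ?case
  proof (cases "d = 1")
    case True
    then show ?thesis by (intro bexI[of _ \<one>]) auto
  next
    case False
    then obtain p where p: "prime p" "p dvd d" using prime_factor_nat by blast
    define a where "a = multiplicity p d"
    obtain d' where d': "d = p ^ a * d'" "\<not> p dvd d'"
      unfolding a_def using multiplicity_decompose'[of d p] d0 p(1) by (metis not_prime_unit)
    have a: "a > 0" using p d0 by (simp add: a_def prime_multiplicity_gt_zero_iff)
    have "p ^ a > 1" using a prime_gt_1_nat[OF p(1)] by (intro one_less_power)
    then have "d' < d" using d'(1) d0 by (simp add: d'(1))
    moreover have "d' dvd group_exponent G" using d' less.prems by (metis dvd_mult_right)
    ultimately obtain h where h: "h \<in> carrier G" "ord h = d'" using less.IH by blast
    have "p ^ a dvd group_exponent G" using d' less.prems by (metis dvd_mult_left)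
    then obtain g where g: "g \<in> carrier G" "p ^ a dvd ord g"
      using prime_power_dvd_Lcm[of "ord ` carrier G" p a] fin p(1) zero a
      by (auto simp: group_exponent_def)
    then obtain k where k: "ord g = p ^ a * k" by blast
    have "ord g \<noteq> 0" using g zero by (metis image_eqI)
    then have k0: "k \<noteq> 0" "p ^ a \<noteq> 0" using k by auto
    have "ord (g [^] k) = p ^ a"
      using g(1) k k0 by (simp add: ord_pow_gen)
    moreover have "coprime (p ^ a) d'"
      using p(1) d'(2) by (simp add: prime_imp_coprime)
    ultimately have "ord (g [^] k \<otimes> h) = d"
      using g h d'(1) by (simp add: ord_mult_coprime)
    then show ?thesis using g h by blast
  qed
qed

section \<open>Extension of characters from subgroups\<close>

definition partial_character :: "'a set \<Rightarrow> ('a \<Rightarrow> complex) \<Rightarrow> bool" where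
  "partial_character H f \<longleftrightarrow> H \<subseteq> carrier G \<and> \<one> \<in> H \<and> f \<one> = 1 \<and>
     (\<forall>x\<in>H. \<forall>y\<in>H. x \<otimes> y \<in> H \<and> f (x \<otimes> y) = f x * f y)"

lemma partial_character_pow:
  assumes "partial_character H f" "x \<in> H"
  shows "x [^] (n::nat) \<in> H \<and> f (x [^] n) = f x ^ n"
  using assms by (induction n) (auto simp: partial_character_def)

text \<open>In a finite group inverses are powers, so the domain \<open>H\<close> of a partial
  character is a subgroup.\<close>

lemma partial_character_inv:
  assumes "partial_character H f" "x \<in> H" "finite (carrier G)"
  shows "inv x \<in> H"
proof -
  have x: "x \<in> carrier G" using assms by (auto simp: partial_character_def)
  have "ord x \<ge> 1" using ord_ge_1[OF assms(3) x] .
  then have "x [^] (ord x - 1) \<otimes> x = x [^] ord x" by (metis nat_pow_Suc Suc_diff_1 Suc_le_lessD One_nat_def)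
  also have "\<dots> = \<one>" using x by simp
  finally have "inv x = x [^] (ord x - 1)" using x by (intro inv_equality) auto
  then show ?thesis using partial_character_pow[OF assms(1,2)] by simp
qed

text \<open>The elements of the larger subgroup are the \<open>h \<otimes> g [^] i\<close>, with
  value \<open>f h * c ^ i\<close>. This is well defined because \<open>g [^] e\<close> lies in
  \<open>H\<close> only for multiples \<open>e\<close> of \<open>s\<close>, where the condition on
  \<open>c ^ s\<close> ensures agreement.\<close>

lemma partial_character_extend:
  assumes f: "partial_character H f" and fin: "finite (carrier G)" and g: "g \<in> carrier G"
    and s: "s > 0" "g [^] s \<in> H" "\<And>r. 0 < r \<Longrightarrow> r < s \<Longrightarrow> g [^] r \<notin> H"
    and c: "c ^ s = f (g [^] s)"
  obtains H' f' where "partial_character H' f'" "H \<subseteq> H'" "g \<in> H'" "f' g = c"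
    "\<And>x. x \<in> H \<Longrightarrow> f' x = f x"
proof -
  have HG: "h \<in> carrier G" if "h \<in> H" for h using f that by (auto simp: partial_character_def)
  have closed: "x \<otimes> y \<in> H" and mult: "f (x \<otimes> y) = f x * f y" if "x \<in> H" "y \<in> H" for x y
    using f that by (auto simp: partial_character_def)
  note pow = partial_character_pow[OF f] and inv = partial_character_inv[OF f _ fin]
  have fpow: "f (g [^] e) = c ^ e" if e: "g [^] e \<in> H" for e
  proof -
    have eq: "g [^] e = (g [^] s) [^] (e div s) \<otimes> g [^] (e mod s)"
      using g by (simp add: nat_pow_pow nat_pow_mult)
    \<comment> \<open>Dividing out the multiple of \<open>s\<close> leaves a power of
      \<open>g\<close> in \<open>H\<close> with exponent below \<open>s\<close>; minimality of
      \<open>s\<close> makes that exponent 0.\<close>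
    have "g [^] (e mod s) = inv ((g [^] s) [^] (e div s)) \<otimes> g [^] e"
      using g by (subst eq) (simp add: m_assoc[symmetric])
    then have "g [^] (e mod s) \<in> H" using pow[OF s(2)] inv closed e by simp
    then have "e mod s = 0" using s(1) s(3)[of "e mod s"] by (metis mod_less_divisor neq0_conv)
    then have "g [^] e = (g [^] s) [^] (e div s)" "s * (e div s) = e" using eq g by auto
    then show ?thesis using pow[OF s(2)] c by (metis power_mult)
  qed
  have wd_le: "f h * c ^ i = f h' * c ^ j"
    if h: "h \<in> H" "h' \<in> H" "h \<otimes> g [^] i = h' \<otimes> g [^] j" and "i \<le> j" for h h' i j
  proof -
    have "h \<otimes> g [^] i = (h' \<otimes> g [^] (j - i)) \<otimes> g [^] i"
      using h g HG \<open>i \<le> j\<close> by (simp add: m_assoc nat_pow_mult)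
    then have eq: "h = h' \<otimes> g [^] (j - i)" using h g HG by simp
    then have "g [^] (j - i) = inv h' \<otimes> h" using h g HG by (simp add: m_assoc[symmetric])
    then have e: "g [^] (j - i) \<in> H" using h inv closed by simp
    have "f h = f h' * c ^ (j - i)" using eq mult[OF h(2) e] fpow[OF e] by simp
    then show ?thesis using \<open>i \<le> j\<close> by (simp add: mult.assoc flip: power_add)
  qed
  have wd: "f h * c ^ i = f h' * c ^ j"
    if h: "h \<in> H" "h' \<in> H" "h \<otimes> g [^] i = h' \<otimes> g [^] j" for h h' i j
    using wd_le[OF h] wd_le[OF h(2,1) h(3)[symmetric]] by (cases "i \<le> j") auto
  define H' where "H' = {h \<otimes> g [^] (i::nat) | h i. h \<in> H}"
  define f' where "f' y = (SOME w. \<exists>h (i::nat). h \<in> H \<and> y = h \<otimes> g [^] i \<and> w = f h * c ^ i)" for y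
  have f'_eq: "f' (h \<otimes> g [^] i) = f h * c ^ i" if "h \<in> H" for h and i :: nat
  proof -
    have "\<exists>h' (j::nat). h' \<in> H \<and> h \<otimes> g [^] i = h' \<otimes> g [^] j \<and> f' (h \<otimes> g [^] i) = f h' * c ^ j"
      unfolding f'_def by (rule someI[of _ "f h * c ^ i"]) (use that in blast)
    then show ?thesis using wd that by metis
  qed
  have one: "\<one> \<in> H" "f \<one> = 1" using f by (auto simp: partial_character_def)
  show ?thesis
  proof (rule that[of H' f'])
    show "H \<subseteq> H'"
    proof
      fix h assume "h \<in> H"
      then have "h = h \<otimes> g [^] (0::nat)" using HG by simp
      then show "h \<in> H'" using \<open>h \<in> H\<close> unfolding H'_def by blast
    qed
    show "f' h = f h" if "h \<in> H" for h using f'_eq[OF that, of 0] HG[OF that] by simp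
    show "f' g = c" using f'_eq[OF one(1), of 1] one g by simp
    have "g = \<one> \<otimes> g [^] (1::nat)" using g by simp
    then show "g \<in> H'" unfolding H'_def using one by blast
    have "x \<otimes> y \<in> H' \<and> f' (x \<otimes> y) = f' x * f' y" if xy: "x \<in> H'" "y \<in> H'" for x y
    proof -
      obtain h i h' j where hh: "x = h \<otimes> g [^] (i::nat)" "y = h' \<otimes> g [^] (j::nat)" "h \<in> H" "h' \<in> H"
        using xy unfolding H'_def by blast
      have "x \<otimes> y = (h \<otimes> h') \<otimes> (g [^] i \<otimes> g [^] j)"
        unfolding hh using hh(3,4) HG g by (simp add: m_ac)
      then have eq: "x \<otimes> y = (h \<otimes> h') \<otimes> g [^] (i + j)" using g by (simp add: nat_pow_mult)
      have "f' (x \<otimes> y) = f h * f h' * c ^ (i + j)"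
        unfolding eq using f'_eq closed mult hh(3,4) by simp
      moreover have "x \<otimes> y \<in> H'" unfolding eq H'_def using closed[OF hh(3,4)] by blast
      ultimately show ?thesis using hh f'_eq by (simp add: power_add)
    qed
    moreover have "\<one> \<in> H'" using \<open>H \<subseteq> H'\<close> one by auto
    moreover have "f' \<one> = 1" using f'_eq[OF one(1), of 0] one by simp
    moreover have "H' \<subseteq> carrier G" unfolding H'_def using HG g by auto
    ultimately show "partial_character H' f'" by (simp add: partial_character_def)
  qed
qed

lemma partial_character_extend_one:
  assumes f: "partial_character H f" and fin: "finite (carrier G)" and g: "g \<in> carrier G"
  shows "\<exists>H' f'. partial_character H' f' \<and> H \<subseteq> H' \<and> g \<in> H' \<and> (\<forall>x\<in>H. f' x = f x)"
proof -
  define s where "s = (LEAST s::nat. 0 < s \<and> g [^] s \<in> H)"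
  have "0 < ord g \<and> g [^] ord g \<in> H"
    using ord_ge_1[OF fin g] g f by (auto simp: partial_character_def)
  then have s: "0 < s" "g [^] s \<in> H"
    unfolding s_def using LeastI[of "\<lambda>s::nat. 0 < s \<and> g [^] s \<in> H"] by blast+
  have least: "g [^] r \<notin> H" if "0 < r" "r < s" for r :: nat
    using that not_less_Least[of r "\<lambda>s::nat. 0 < s \<and> g [^] s \<in> H"] unfolding s_def by blast
  let ?w = "f (g [^] s)"
  \<comment> \<open>The polar form supplies an \<open>s\<close>-th root of the value at
    \<open>g [^] s\<close>, as required of \<open>c\<close>.\<close>
  have "rcis (root s (cmod ?w)) (Arg ?w / s) ^ s = ?w"
    using s(1) by (simp add: DeMoivre2 rcis_cmod_Arg)
  then obtain c where "c ^ s = ?w" by blast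
  then show ?thesis using partial_character_extend[OF f fin g s least, of c] by metis
qed

text \<open>Extending the trivial character of the trivial subgroup by \<open>g\<close> allows any
  value \<open>c\<close> at \<open>g\<close> with \<open>c ^ ord g = 1\<close>; a primitive root is
  chosen. The other elements of the finite group are then adjoined successively.\<close>

lemma ex_character_of_order:
  assumes fin: "finite (carrier G)" and g: "g \<in> carrier G"
  shows "\<exists>f. partial_character (carrier G) f \<and> f g = cis (2 * pi / ord g)"
proof -
  have triv: "partial_character {\<one>} (\<lambda>_. 1)" by (simp add: partial_character_def)
  have n: "ord g > 0" using ord_ge_1[OF fin g] by simp
  have "cis (2 * pi / ord g) ^ ord g = 1" using n by (simp add: DeMoivre)
  then have c: "cis (2 * pi / ord g) ^ ord g = (\<lambda>_. 1) (g [^] ord g)" by simp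
  have pow: "g [^] ord g \<in> {\<one>}" using g by simp
  have least: "g [^] r \<notin> {\<one>}" if "0 < r" "r < ord g" for r
    using that g pow_eq_id[of g r] by (auto dest: dvd_imp_le)
  obtain H f where Hf: "partial_character H f" "g \<in> H" "f g = cis (2 * pi / ord g)"
    by (rule partial_character_extend[OF triv fin g n pow _ c]) (use least that in \<open>simp_all; blast\<close>)
  have "\<exists>H' f'. partial_character H' f' \<and> H \<subseteq> H' \<and> A \<subseteq> H' \<and> (\<forall>x\<in>H. f' x = f x)"
    if "finite A" "A \<subseteq> carrier G" for A
    using that
  proof (induction A)
    case empty
    then show ?case using Hf by blast
  next
    case (insert a A)
    then obtain H1 f1 where 1: "partial_character H1 f1" "H \<subseteq> H1" "A \<subseteq> H1" "\<forall>x\<in>H. f1 x = f x"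
      by auto
    obtain H2 f2 where 2: "partial_character H2 f2" "H1 \<subseteq> H2" "a \<in> H2" "\<forall>x\<in>H1. f2 x = f1 x"
      using partial_character_extend_one[OF 1(1) fin, of a] insert.prems by auto
    show ?case
      using 1 2 by (intro exI[of _ H2] exI[of _ f2]) (auto simp: subset_iff)
  qed
  from this[OF fin subset_refl] obtain H' f' where H': "partial_character H' f'"
    "carrier G \<subseteq> H'" "\<forall>x\<in>H. f' x = f x"
    by (elim exE conjE)
  have "H' = carrier G" using H'(1,2) by (simp add: partial_character_def subset_antisym)
  moreover have "f' g = cis (2 * pi / ord g)" using H'(3) Hf by simp
  ultimately show ?thesis using H'(1) by blast
qed

text \<open>A character with a primitive value at an element of order exp(G) is raised to the power
  \<open>k\<close>, the quotient of exp(G) by \<open>d\<close>. As exp(G) annihilates the group, all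
  values become \<open>d\<close>-th roots of unity.\<close>

lemma ex_character_onto_roots_of_unity:
  assumes fin: "finite (carrier G)" and d: "d dvd group_exponent G"
  shows "\<exists>f. partial_character (carrier G) f \<and> (\<forall>x\<in>carrier G. f x ^ d = 1) \<and>
    (\<exists>g\<in>carrier G. f g = cis (2 * pi / d))"
proof -
  obtain g where g: "g \<in> carrier G" "ord g = group_exponent G"
    using ex_element_of_order[OF fin dvd_refl] by blast
  obtain f where f: "partial_character (carrier G) f" "f g = cis (2 * pi / ord g)"
    using ex_character_of_order[OF fin g(1)] by blast
  obtain k where k: "group_exponent G = d * k" using d by blast
  have pos: "d > 0" "k > 0" using ord_ge_1[OF fin g(1)] g(2) k by (auto intro: gr0I)
  show ?thesis
  proof (intro exI[of _ "\<lambda>x. f x ^ k"] conjI ballI bexI[of _ g])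
    show "partial_character (carrier G) (\<lambda>x. f x ^ k)"
      using f(1) by (simp add: partial_character_def power_mult_distrib)
    fix x assume x: "x \<in> carrier G"
    have "ord x dvd d * k" using x fin k[symmetric] by (simp add: group_exponent_def dvd_Lcm)
    then have "x [^] (d * k) = \<one>" using pow_eq_id[OF x] by blast
    then have "f x ^ (d * k) = 1"
      using partial_character_pow[OF f(1) x, of "d * k"] f(1) by (simp add: partial_character_def)
    then show "(f x ^ k) ^ d = 1" by (metis power_mult mult.commute)
  next
    show "f g ^ k = cis (2 * pi / d)" using f(2) g(2) k pos by (simp add: DeMoivre)
  qed (use g in auto)
qed

end

section \<open>Dividing out a self-conjugate integer\<close>

text \<open>The product of the squared norms is \<open>l * l\<close>, so a prime of \<open>n\<close>
  divides one of them and, being self-conjugate, divides \<open>x\<close> or \<open>y\<close> in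
  Z[z]. After division by it the same conditions hold for the rest of \<open>n\<close>.\<close>

lemma self_conjugate_factorization:
  assumes z: "z ^ d = 1" "d > 2"
    and n: "n > 0" "\<And>p. prime p \<Longrightarrow> p dvd n \<Longrightarrow> self_conjugate_prime p d \<and> coprime p d"
    and x: "x \<in> int_adjoin z" and y: "y \<in> int_adjoin z"
    and l: "cnj x * y = of_int l" "l \<noteq> 0" "int n dvd l"
    and norm: "x * cnj x = of_int a" "y * cnj y = of_int b"
  shows "\<exists>c1 c2 x' y'. n = c1 * c2 \<and> x' \<in> int_adjoin z \<and> y' \<in> int_adjoin z \<and>
    x = of_nat c1 * x' \<and> y = of_nat c2 * y'"
  using n x y l norm
proof (induction n arbitrary: x y l a b rule: prime_divisors_induct)
  case (unit n)
  then show ?case by (intro exI[of _ 1] exI[of _ x] exI[of _ y]) auto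
next
  case (factor p n)
  note p = \<open>prime p\<close>
  have p0: "p > 0" using p by (rule prime_gt_0_nat)
  have sc: "self_conjugate_prime p d" "coprime p d" using factor.prems(2)[OF p] by simp_all
  have nonneg: "n > 0" using factor.prems(1) by simp
  have n_prime: "self_conjugate_prime q d \<and> coprime q d" if "prime q" "q dvd n" for q
    using factor.prems(2)[OF that(1)] that(2) by simp
  \<comment> \<open>Stated for arbitrary arguments, so that it also serves with \<open>x\<close> and
    \<open>y\<close> exchanged.\<close>
  have step: "\<exists>c1 c2 x' y'. p * n = c1 * c2 \<and> x' \<in> int_adjoin z \<and> y' \<in> int_adjoin z \<and>
      x = of_nat c1 * x' \<and> y = of_nat c2 * y'"
    if x: "x \<in> int_adjoin z" and y: "y \<in> int_adjoin z"
      and l: "cnj x * y = of_int l" "l \<noteq> 0" "int (p * n) dvd l"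
      and norm: "x * cnj x = of_int a" "y * cnj y = of_int b" and dvd: "int p dvd a" for x y l a b
  proof -
    obtain k where k: "a = int p * k" using dvd by blast
    then obtain x1 where x1: "x1 \<in> int_adjoin z" "x = of_nat p * x1"
      using self_conjugate_prime_dvd[OF z x p sc, of k] norm(1) by auto
    obtain l1 where l1: "l = int p * int n * l1" using l(3) by (auto elim: dvdE)
    have 1: "cnj x1 * y = of_int (int n * l1)"
      using l(1) l1 x1(2) p0 by simp
    have "of_nat p * of_nat p * (x1 * cnj x1) = of_int a"
      using norm(1) x1(2) by (simp add: mult_ac)
    \<comment> \<open>The induction hypothesis asks for an integral norm: the new norm is rational
      and lies in Z[z].\<close>
    then have "x1 * cnj x1 = of_int a / (of_nat p * of_nat p)" using p0 by (simp add: field_simps)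
    then have "x1 * cnj x1 \<in> \<rat>" by simp
    moreover have "x1 * cnj x1 \<in> int_adjoin z"
      using x1(1) int_adjoin_cnj[OF z(1) _ x1(1)] z(2) by (intro int_adjoin_mult) simp_all
    ultimately obtain a1 where a1: "x1 * cnj x1 = of_int a1"
      using int_adjoin_rational[OF z(1)] z(2) by (metis Ints_cases gr_zeroI not_less_zero)
    have nz: "int n * l1 \<noteq> 0" using l(2) l1 by auto
    obtain c1 c2 x' y' where "n = c1 * c2" "x' \<in> int_adjoin z" "y' \<in> int_adjoin z"
      "x1 = of_nat c1 * x'" "y = of_nat c2 * y'"
      using factor.IH[OF nonneg n_prime x1(1) y 1 nz dvd_triv_left a1 norm(2)] by auto
    then show ?thesis
      using x1(2) by (intro exI[of _ "p * c1"] exI[of _ c2] exI[of _ x'] exI[of _ y']) auto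
  qed
  \<comment> \<open>Since \<open>l\<close> is real, conjugation exchanges the roles of
    \<open>x\<close> and \<open>y\<close>.\<close>
  have swap: "cnj y * x = of_int l"
    using arg_cong[OF factor.prems(5), of cnj] by (simp add: mult.commute)
  have "complex_of_int (l * l) = (cnj x * y) * (cnj y * x)"
    using factor.prems(5) swap by simp
  also have "\<dots> = (x * cnj x) * (y * cnj y)" by (simp add: mult_ac)
  also have "\<dots> = of_int (a * b)" using factor.prems(8,9) by simp
  finally have "l * l = a * b" by (simp only: of_int_eq_iff)
  moreover have "int p dvd l" using factor.prems(7) by (metis dvd_mult_left of_nat_mult)
  ultimately have "int p dvd a * b" by (metis dvd_mult)
  then have "int p dvd a \<or> int p dvd b" using p by (simp add: prime_dvd_mult_iff)
  then show ?case
  proof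
    assume "int p dvd a"
    then show ?thesis using step factor.prems by blast
  next
    assume "int p dvd b"
    then obtain c1 c2 x' y' where "p * n = c1 * c2" "x' \<in> int_adjoin z" "y' \<in> int_adjoin z"
      "y = of_nat c1 * x'" "x = of_nat c2 * y'"
      using step[OF factor.prems(4,3) swap factor.prems(6,7,9,8)] by blast
    then show ?thesis
      by (intro exI[of _ c2] exI[of _ c1] exI[of _ y'] exI[of _ x']) auto
  qed
qed simp

section \<open>Difference operators and Fourier inversion on \<open>\<int>/d\<close>\<close>

text \<open>Functions on Z/d are modelled on \<open>int\<close>, so that they can be translated by
  any amount.\<close>

definition periodic :: "nat \<Rightarrow> (int \<Rightarrow> 'b) \<Rightarrow> bool" where
  "periodic d f \<longleftrightarrow> (\<forall>k. f (k + int d) = f k)"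

definition fourier :: "nat \<Rightarrow> (int \<Rightarrow> int) \<Rightarrow> complex \<Rightarrow> complex" where
  "fourier d f w = (\<Sum>k<d. of_int (f (int k)) * w ^ k)"

lemma sum_periodic_shift:
  fixes g :: "int \<Rightarrow> complex"
  assumes "periodic d g"
  shows "(\<Sum>k<d. g (int k + int a)) = (\<Sum>k<d. g (int k))"
proof (induction a)
  case (Suc a)
  have "g (int a) + (\<Sum>k<d. g (int k + int (Suc a))) = g (int 0 + int a) + (\<Sum>k<d. g (int (Suc k) + int a))"
    by (simp add: add_ac)
  also have "\<dots> = (\<Sum>k<Suc d. g (int k + int a))" by (rule sum.lessThan_Suc_shift[symmetric])
  also have "\<dots> = (\<Sum>k<d. g (int k + int a)) + g (int a + int d)" by (simp add: add_ac)
  finally show ?case using Suc assms by (simp add: periodic_def)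
qed simp

lemma fourier_diff:
  assumes "periodic d f" "w ^ d = 1" "d > 0"
  shows "fourier d (\<lambda>k. f k - f (k - int a)) w = (1 - w ^ a) * fourier d f w"
proof -
  have w: "w \<noteq> 0" using assms(2,3) by (auto simp: power_0_left)
  \<comment> \<open>Integer exponents keep the summand meaningful and periodic at the negative
    arguments caused by the shift.\<close>
  define g where "g k = of_int (f (k - int a)) * w powi (k - int a)" for k
  have "periodic d g"
    unfolding periodic_def
  proof
    fix k
    have "f (k + int d - int a) = f (k - int a)"
      using assms(1) unfolding periodic_def by (metis add_diff_eq add.commute)
    moreover have "w powi (k + int d - int a) = w powi (k - int a)"
    proof -
      have "w powi (k - int a + int d) = w powi (k - int a) * w powi int d"
        using w by (intro power_int_add) simp
      then show ?thesis using assms(2) by (simp add: algebra_simps)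
    qed
    ultimately show "g (k + int d) = g k" by (simp add: g_def)
  qed
  then have "(\<Sum>k<d. g (int k + int a)) = (\<Sum>k<d. g (int k))" by (rule sum_periodic_shift)
  moreover have "(\<Sum>k<d. g (int k + int a)) = fourier d f w"
    by (simp add: g_def fourier_def)
  moreover have "w ^ a * g (int k) = of_int (f (int k - int a)) * w ^ k" for k
  proof -
    have "w ^ a * w powi (int k - int a) = w powi int k"
      using power_int_add[of w "int a" "int k - int a"] w by simp
    then show ?thesis by (simp add: g_def mult.left_commute)
  qed
  then have "w ^ a * (\<Sum>k<d. g (int k)) = (\<Sum>k<d. of_int (f (int k - int a)) * w ^ k)"
    by (simp add: sum_distrib_left)
  ultimately show ?thesis
    by (simp add: fourier_def algebra_simps sum_subtractf)
qed

lemma periodic_diff: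
  fixes f :: "int \<Rightarrow> int"
  assumes "periodic d f"
  shows "periodic d (\<lambda>k. f k - f (k - int a))"
  using assms unfolding periodic_def by (metis add_diff_eq add.commute)

text \<open>The operators with steps \<open>s a\<close> are applied in turn; each at most doubles
  the bound, by the triangle inequality.\<close>

lemma iterated_difference:
  fixes f :: "int \<Rightarrow> int"
  assumes "finite S" "periodic d f" "d > 0" "\<And>k. \<bar>f k\<bar> \<le> B"
  shows "\<exists>h. periodic d h \<and> (\<forall>k. \<bar>h k\<bar> \<le> 2 ^ card S * B) \<and>
    (\<forall>w. w ^ d = 1 \<longrightarrow> fourier d h w = (\<Prod>a\<in>S. 1 - w ^ s a) * fourier d f w)"
  using assms(1)
proof (induction S)
  case empty
  then show ?case using assms by (intro exI[of _ f]) auto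
next
  case (insert a S)
  then obtain h where h: "periodic d h" "\<And>k. \<bar>h k\<bar> \<le> 2 ^ card S * B"
    "\<And>w. w ^ d = 1 \<Longrightarrow> fourier d h w = (\<Prod>a\<in>S. 1 - w ^ s a) * fourier d f w" by blast
  have "\<bar>h k - h (k - int (s a))\<bar> \<le> 2 ^ card (insert a S) * B" for k
    using h(2)[of k] h(2)[of "k - int (s a)"] insert by simp
  then show ?case
    using h insert by (intro exI[of _ "\<lambda>k. h k - h (k - int (s a))"])
      (auto simp: periodic_diff fourier_diff assms(3))
qed

section \<open>Orthogonality of roots of unity and Fourier inversion\<close>

lemma cis_power_eq_1_iff:
  fixes d k :: nat
  assumes "d > 0"
  shows "cis (2 * pi / d) ^ k = 1 \<longleftrightarrow> d dvd k"
proof -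
  let ?z = "cis (2 * pi / d)"
  have zd: "?z ^ d = 1" using assms by (simp add: DeMoivre)
  have "?z ^ k = ?z ^ (k mod d)"
    using zd by (rule root_of_unity_power_cong) (simp add: cong_def)
  moreover have "?z ^ (k mod d) = ?z ^ 0 \<longleftrightarrow> k mod d = 0"
  proof
    assume "?z ^ (k mod d) = ?z ^ 0"
    then have "cis (2 * pi * real (k mod d) / real d) = cis (2 * pi * real 0 / real d)"
      by (simp add: DeMoivre mult_ac)
    then show "k mod d = 0"
      using bij_betw_imp_inj_on[OF bij_betw_roots_unity[OF assms]] assms
      by (auto simp: inj_on_def)
  qed simp
  ultimately show ?thesis by (simp add: dvd_eq_mod_eq_0)
qed

lemma cis_power_eq_iff:
  fixes d i j :: nat
  assumes "d > 0" "i < d" "j < d"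
  shows "cis (2 * pi / d) ^ i = cis (2 * pi / d) ^ j \<longleftrightarrow> i = j"
proof -
  have *: "i = j" if "cis (2 * pi / d) ^ i = cis (2 * pi / d) ^ j" "i \<le> j" "j < d" for i j :: nat
  proof -
    have "cis (2 * pi / d) ^ i * cis (2 * pi / d) ^ (j - i) = cis (2 * pi / d) ^ j"
      using that(2) by (simp only: power_add[symmetric] le_add_diff_inverse)
    then have "cis (2 * pi / d) ^ i * cis (2 * pi / d) ^ (j - i) = cis (2 * pi / d) ^ i * 1"
      using that(1) by simp
    then have "cis (2 * pi / d) ^ (j - i) = 1" by (subst (asm) mult_cancel_left) simp
    then have "d dvd j - i" using cis_power_eq_1_iff[OF assms(1)] by blast
    then show ?thesis using that by (auto dest: dvd_imp_le)
  qed
  show ?thesis using *[of i j] *[of j i] assms by (metis nle_le)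
qed

lemma root_of_unity_eq_cis_power:
  fixes w :: complex
  assumes "d > 0" "w ^ d = 1"
  shows "\<exists>k<d. w = cis (2 * pi / real d) ^ k"
proof -
  have "w \<in> {w. w ^ d = 1}" using assms(2) by simp
  then obtain k where "k < d" "w = cis (2 * pi * real k / real d)"
    using bij_betw_imp_surj_on[OF bij_betw_roots_unity[OF assms(1)]]
    by (metis (no_types, lifting) imageE lessThan_iff)
  then show ?thesis by (auto simp: DeMoivre mult_ac)
qed

lemma sum_powers_root_of_unity:
  fixes u :: complex
  assumes "u ^ d = 1" "u \<noteq> 1"
  shows "(\<Sum>j<d. u ^ j) = 0"
proof -
  have "(1 - u) * (\<Sum>j<d. u ^ j) = 0" using one_diff_power_eq[of u d] assms(1) by simp
  then show ?thesis using assms(2) by simp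
qed

text \<open>The factor \<open>z ^ (j * (d - m))\<close> is the inverse of
  \<open>z ^ (j * m)\<close>, written with natural exponents. Exchanging the sums leaves geometric
  sums of roots of unity, which vanish unless \<open>k = m\<close>.\<close>

lemma fourier_inversion:
  assumes "d > 0" "m < d" and z: "z = cis (2 * pi / d)"
  shows "(\<Sum>j<d. fourier d h (z ^ j) * z ^ (j * (d - m))) = of_int (int d * h (int m))"
proof -
  have zd: "z ^ d = 1" using assms by (simp add: DeMoivre)
  have pow: "(z ^ (k + e)) ^ j = (z ^ j) ^ k * z ^ (j * e)" for k e j
    by (simp only: power_mult[symmetric] power_add[symmetric]) (simp add: algebra_simps)
  have "(\<Sum>j<d. fourier d h (z ^ j) * z ^ (j * (d - m)))
      = (\<Sum>j<d. \<Sum>k<d. of_int (h (int k)) * (z ^ (k + (d - m))) ^ j)"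
    by (simp only: fourier_def sum_distrib_right pow mult.assoc)
  also have "\<dots> = (\<Sum>k<d. of_int (h (int k)) * (\<Sum>j<d. (z ^ (k + (d - m))) ^ j))"
    by (subst sum.swap) (simp add: sum_distrib_left)
  also have "\<dots> = (\<Sum>k<d. if k = m then of_int (h (int m)) * of_nat d else 0)"
  proof (intro sum.cong refl)
    fix k assume k: "k \<in> {..<d}"
    show "of_int (h (int k)) * (\<Sum>j<d. (z ^ (k + (d - m))) ^ j)
      = (if k = m then of_int (h (int m)) * of_nat d else 0)"
    proof (cases "k = m")
      case True
      then show ?thesis using assms(2) zd by simp
    next
      case False
      have "z ^ (k + (d - m)) \<noteq> 1"
      proof
        assume "z ^ (k + (d - m)) = 1"
        then have "z ^ (k + (d - m)) * z ^ m = z ^ m" by simp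
        then have "z ^ k = z ^ m" using assms(2) zd by (simp flip: power_add) (simp add: power_add)
        then show False using False k assms(2) cis_power_eq_iff[OF assms(1)] z by simp
      qed
      moreover have "(z ^ (k + (d - m))) ^ d = 1" by (metis zd mult.commute power_mult power_one)
      ultimately show ?thesis using sum_powers_root_of_unity False by simp
    qed
  qed
  also have "\<dots> = of_int (int d * h (int m))" using assms(2) by simp
  finally show ?thesis .
qed

lemma root_of_unity_sum_bound:
  fixes f :: "int \<Rightarrow> int"
  assumes d: "d > 1" and f: "periodic d f" "\<And>k. 0 \<le> f k" "\<And>k. f k \<le> B"
    and z: "z = cis (2 * pi / d)" and nz: "fourier d f z \<noteq> 0"
    and c: "fourier d f z = of_nat c * y" "y \<in> int_adjoin z" "coprime c d"
  shows "int c \<le> 2 ^ (card (prime_factors d) - 1) * B"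
proof -
  have d0: "d > 0" using d by simp
  have zd: "z ^ d = 1" using z d by (simp add: DeMoivre)
  obtain p where p: "p \<in> prime_factors d"
    using d
    by (metis in_prime_factors_iff less_numeral_extra(4) not_less_zero prime_factor_nat)
  define S where "S = prime_factors d - {p}"
  have Sp: "finite S" "insert p S = prime_factors d" "p \<notin> S" using p by (auto simp: S_def)
  \<comment> \<open>The difference for \<open>p\<close> is singled out: because \<open>f\<close>
    lies between 0 and \<open>B\<close>, it keeps the bound \<open>B\<close>, and only the operators
    for the other primes, in \<open>S\<close>, double it.\<close>
  define f1 where "f1 k = f k - f (k - int (d div p))" for k
  have f1: "periodic d f1" unfolding f1_def using f(1) by (rule periodic_diff)
  have "\<bar>f1 k\<bar> \<le> B" for k
    using f(2)[of k] f(3)[of k] f(2)[of "k - int (d div p)"] f(3)[of "k - int (d div p)"]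
    by (simp add: f1_def)
  from iterated_difference[OF Sp(1) f1 d0 this, of "\<lambda>q. d div q"]
  obtain h where h: "periodic d h" "\<And>k. \<bar>h k\<bar> \<le> 2 ^ card S * B"
    "\<And>w. w ^ d = 1 \<Longrightarrow> fourier d h w = (\<Prod>q\<in>S. 1 - w ^ (d div q)) * fourier d f1 w" by blast
  have hf: "fourier d h w = (\<Prod>q\<in>prime_factors d. 1 - w ^ (d div q)) * fourier d f w"
    if "w ^ d = 1" for w
    using h(3)[OF that] fourier_diff[OF f(1) that d0, of "d div p"] Sp
    by (simp add: f1_def[abs_def] flip: Sp(2))
  have div_pos: "\<not> d dvd d div q" if "q \<in> prime_factors d" for q
  proof -
    have "q > 1" "q dvd d" using that prime_gt_1_nat[of q] by (auto simp: in_prime_factors_iff)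
    then have "0 < d div q" "d div q < d" using d0 by (auto simp: dvd_div_eq_0_iff)
    then show ?thesis by (auto dest: dvd_imp_le)
  qed
  define F where "F = (\<Sum>k<d. monom (f (int k)) k)"
  have F: "int_eval F w = fourier d f w" for w
  proof -
    have "int_eval (sum (\<lambda>k. monom (f (int k)) k) A) w = (\<Sum>k\<in>A. of_int (f (int k)) * w ^ k)" for A
      by (induction A rule: infinite_finite_induct) simp_all
    then show ?thesis by (simp add: F_def fourier_def)
  qed
  obtain H where H: "y = int_eval H z" using c(2) by (auto simp: int_adjoin_iff)
  \<comment> \<open>For \<open>j\<close> coprime to \<open>d\<close> the divisibility is transferred
    from \<open>z\<close> to \<open>z ^ j\<close>. Otherwise a common prime \<open>q\<close> of
    \<open>j\<close> and \<open>d\<close> makes the factor \<open>1 - (z ^ j) ^ (d div q)\<close>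
    vanish.\<close>
  have divides: "\<exists>u\<in>int_adjoin z. fourier d h (z ^ j) = of_nat c * u" for j
  proof -
    have zj: "(z ^ j) ^ d = 1" by (metis zd mult.commute power_mult power_one)
    show ?thesis
    proof (cases "coprime j d")
      case True
      have "int_eval F z = of_nat c * int_eval H z" using c(1) F H by simp
      then have "int_eval F (z ^ j) = of_nat c * int_eval H (z ^ j)"
        by (rule int_eval_dvd_coprime_power[OF zd d0 True])
      then have eq: "fourier d h (z ^ j) =
          of_nat c * ((\<Prod>q\<in>prime_factors d. 1 - (z ^ j) ^ (d div q)) * int_eval H (z ^ j))"
        using hf[OF zj] F by simp
      have "int_eval H (z ^ j) = int_eval (pcompose H (monom 1 j)) z"
        by (simp add: int_eval_pcompose)
      then have "int_eval H (z ^ j) \<in> int_adjoin z" by simp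
      moreover have "(\<Prod>q\<in>A. 1 - (z ^ j) ^ (d div q)) \<in> int_adjoin z" for A
      proof (induction A rule: infinite_finite_induct)
        case (insert q A)
        have "(z ^ j) ^ (d div q) \<in> int_adjoin z" using int_adjoin_power_self[of z 1]
          by (intro int_adjoin_power) simp
        then show ?case using insert int_adjoin_of_int[of 1 z]
          by (auto intro: int_adjoin_mult int_adjoin_diff)
      qed (use int_adjoin_of_int[of 1 z] in auto)
      ultimately show ?thesis using eq int_adjoin_mult by blast
    next
      case False
      then obtain q where "prime q" "q dvd gcd j d"
        using prime_factor_nat[of "gcd j d"] by (auto simp: coprime_iff_gcd_eq_1)
      then have q: "prime q" "q dvd j" "q dvd d" by simp_all
      then obtain j' where "j = q * j'" by blast
      then have "j * (d div q) = d * j'" using q(3) by simp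
      then have "d dvd j * (d div q)" by simp
      then have "(z ^ j) ^ (d div q) = 1"
        using cis_power_eq_1_iff[OF d0] z by (simp flip: power_mult)
      moreover have "q \<in> prime_factors d" using q d0 by (simp add: in_prime_factors_iff)
      ultimately have "(\<Prod>q\<in>prime_factors d. 1 - (z ^ j) ^ (d div q)) = 0"
        by (intro prod_zero) auto
      then have "fourier d h (z ^ j) = of_nat c * 0" using hf[OF zj] by simp
      then show ?thesis using int_adjoin_of_int[of 0 z] by force
    qed
  qed
  \<comment> \<open>Inversion shows that \<open>c\<close> divides \<open>d * h m\<close>;
    coprimality of \<open>c\<close> and \<open>d\<close> removes the factor
    \<open>d\<close>.\<close>
  have c_dvd: "int c dvd h (int m)" if m: "m < d" for m
  proof -
    obtain u where u: "\<And>j. u j \<in> int_adjoin z" "\<And>j. fourier d h (z ^ j) = of_nat c * u j"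
      using divides by metis
    have "of_int (int d * h (int m)) = of_int (int c) * (\<Sum>j<d. u j * z ^ (j * (d - m)))"
      using fourier_inversion[OF d0 m z, of h] u(2) by (simp add: sum_distrib_left mult.assoc)
    moreover have "(\<Sum>j<d. u j * z ^ (j * (d - m))) \<in> int_adjoin z"
      using u(1) by (intro int_adjoin_sum int_adjoin_mult) simp_all
    ultimately have "int c dvd int d * h (int m)" using int_adjoin_of_int_dvd[OF zd d0] by blast
    then show ?thesis using c(3) by (simp add: coprime_dvd_mult_right_iff)
  qed
  \<comment> \<open>At the primitive root \<open>z\<close> no factor vanishes, so \<open>h\<close>
    has a nonzero value, whose size is at least \<open>c\<close>.\<close>
  have "(\<Prod>q\<in>prime_factors d. 1 - z ^ (d div q)) \<noteq> 0"
    using div_pos cis_power_eq_1_iff[OF d0] z by auto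
  then have "fourier d h z \<noteq> 0" using hf[OF zd] nz by simp
  then obtain m where m: "m < d" "h (int m) \<noteq> 0"
    unfolding fourier_def by (metis (no_types, lifting) lessThan_iff mult_zero_left of_int_0 sum.neutral)
  have "int c \<le> \<bar>h (int m)\<bar>" using dvd_imp_le_int[OF m(2) c_dvd[OF m(1)]] by simp
  also have "\<dots> \<le> 2 ^ card S * B" by (rule h(2))
  also have "card S = card (prime_factors d) - 1" using Sp p by (simp add: S_def)
  finally show ?thesis .
qed

section \<open>Character values of strong external difference families\<close>

lemma sum_mset_eq_sum_count:
  fixes f :: "'c \<Rightarrow> 'd::comm_semiring_1"
  assumes "finite C" "set_mset M \<subseteq> C"
  shows "(\<Sum>x\<in>#M. f x) = (\<Sum>x\<in>C. of_nat (count M x) * f x)"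
  using assms(2)
proof (induction M)
  case (add a M)
  have "(\<Sum>x\<in>C. of_nat (count (add_mset a M) x) * f x)
      = (\<Sum>x\<in>C. of_nat (count M x) * f x + (if x = a then f x else 0))"
    by (intro sum.cong) (auto simp: algebra_simps)
  also have "\<dots> = (\<Sum>x\<in>C. of_nat (count M x) * f x) + f a"
    using add.prems assms(1) by (simp add: sum.distrib)
  finally show ?case using add by (simp add: add.commute)
qed simp

text \<open>All \<open>X j\<close> are real multiples \<open>a j * S\<close> of their sum \<open>S\<close>, and every \<open>a j\<close> is a root of the
  same quadratic \<open>T\<^sup>2 - T = lam / |S|\<^sup>2\<close>. As the \<open>a j\<close> sum to \<open>1\<close>, the roots are rational
  unless both occur \<open>m / 2\<close> times, which forces \<open>m = 2\<close>.\<close>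

lemma rational_norm_of_difference_equations:
  fixes X :: "nat \<Rightarrow> complex" and m :: nat and lam :: nat
  assumes "m \<ge> 3" "lam > 0"
    and S: "S = (\<Sum>j\<in>{1..m}. X j)"
    and eq: "\<And>j. j \<in> {1..m} \<Longrightarrow> (S - X j) * cnj (X j) = - of_nat lam"
    and i: "i \<in> {1..m}"
  shows "X i * cnj (X i) \<in> \<rat>"
proof (cases "S = 0")
  \<comment> \<open>Here the equation reduces to \<open>X i * cnj (X i) = lam\<close>.\<close>
  case True
  then show ?thesis using eq[OF i] by simp
next
  case False
  define N where "N = (cmod S)\<^sup>2"
  have N: "N > 0" "S * cnj S = of_real N"
  proof -
    show "N > 0" using False by (simp add: N_def)
    show "S * cnj S = of_real N" unfolding N_def by (rule complex_norm_square[symmetric])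
  qed
  \<comment> \<open>The equation says that \<open>S * cnj (X j)\<close> is the real number
    \<open>|X j|^2 - lam\<close>; dividing by \<open>|S|^2\<close> gives the real factor with
    \<open>X j = a j * S\<close>.\<close>
  define a where "a j = ((cmod (X j))\<^sup>2 - real lam) / N" for j
  have Xa: "X j = of_real (a j) * S" if "j \<in> {1..m}" for j
  proof -
    have "S * cnj (X j) - X j * cnj (X j) = - of_nat lam"
      using eq[OF that] by (simp only: left_diff_distrib)
    then have "S * cnj (X j) = X j * cnj (X j) - of_nat lam"
      by (metis add.commute diff_eq_eq uminus_add_conv_diff)
    also have "\<dots> = of_real ((cmod (X j))\<^sup>2 - real lam)"
      by (simp only: of_real_diff complex_norm_square of_real_of_nat_eq)
    also have "\<dots> = of_real (a j * N)" using N(1) by (simp add: a_def)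
    also have "\<dots> = S * (of_real (a j) * cnj S)"
      by (simp only: of_real_mult N(2)[symmetric] mult_ac)
    finally have "cnj (X j) = of_real (a j) * cnj S" using False by (simp only: mult_cancel_left) simp
    then have "cnj (cnj (X j)) = cnj (of_real (a j) * cnj S)" by (rule arg_cong)
    then show ?thesis by simp
  qed
  have norm: "X j * cnj (X j) = of_real ((a j)\<^sup>2 * N)" if "j \<in> {1..m}" for j
  proof -
    have "X j * cnj (X j) = of_real (a j) * of_real (a j) * (S * cnj S)"
      unfolding Xa[OF that] by (simp add: mult_ac)
    then show ?thesis by (simp add: N(2) power2_eq_square)
  qed
  have quad: "(a j)\<^sup>2 - a j = real lam / N" if "j \<in> {1..m}" for j
  proof -
    have "of_real ((cmod (X j))\<^sup>2) = complex_of_real ((a j)\<^sup>2 * N)"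
      using norm[OF that] by (simp only: complex_norm_square)
    then have "(cmod (X j))\<^sup>2 = (a j)\<^sup>2 * N" by (simp only: of_real_eq_iff)
    moreover have "a j * N = (cmod (X j))\<^sup>2 - real lam" using N(1) by (simp add: a_def)
    ultimately have "((a j)\<^sup>2 - a j) * N = real lam" by (simp add: left_diff_distrib)
    then show ?thesis using N(1) by (simp add: eq_divide_eq)
  qed
  define \<alpha> where "\<alpha> = a i"
  \<comment> \<open>The two roots of the quadratic add up to 1.\<close>
  have dich: "a j = \<alpha> \<or> a j = 1 - \<alpha>" if "j \<in> {1..m}" for j
  proof -
    have "(a j)\<^sup>2 - a j = \<alpha>\<^sup>2 - \<alpha>" using quad[OF that] quad[OF i] by (simp add: \<alpha>_def)
    then have "(a j - \<alpha>) * (a j + \<alpha> - 1) = 0" by (simp add: algebra_simps power2_eq_square)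
    then show ?thesis by auto
  qed
  have "complex_of_real (\<Sum>j\<in>{1..m}. a j) * S = (\<Sum>j\<in>{1..m}. of_real (a j) * S)"
    by (simp only: of_real_sum sum_distrib_right)
  also have "\<dots> = (\<Sum>j\<in>{1..m}. X j)" by (rule sum.cong[OF refl Xa[symmetric]])
  also have "\<dots> = 1 * S" using S by (simp only: mult_1)
  finally have "complex_of_real (\<Sum>j\<in>{1..m}. a j) = of_real 1" using False by simp
  then have sum1: "(\<Sum>j\<in>{1..m}. a j) = 1" by (simp only: of_real_eq_iff)
  define n where "n = card {j\<in>{1..m}. a j = \<alpha>}"
  have "(\<Sum>j\<in>{1..m}. a j) = (\<Sum>j\<in>{1..m}. (1 - \<alpha>) + (if a j = \<alpha> then 2 * \<alpha> - 1 else 0))"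
    using dich by (intro sum.cong) auto
  also have "\<dots> = m * (1 - \<alpha>) + n * (2 * \<alpha> - 1)"
    by (simp add: sum.distrib sum.inter_filter[symmetric] n_def)
  finally have lin: "\<alpha> * (2 * real n - real m) = 1 - real m + real n"
    using sum1 by (simp add: algebra_simps)
  \<comment> \<open>If \<open>2 * n = m\<close>, then \<open>lin\<close> becomes
    \<open>1 - m + n = 0\<close>, so \<open>m = 2\<close>, against \<open>m \<ge> 3\<close>.\<close>
  have nz: "2 * real n - real m \<noteq> 0"
  proof
    assume "2 * real n - real m = 0"
    then have "real n = real m / 2" "1 - real m + real n = 0" using lin by simp_all
    then show False using assms(1) by simp
  qed
  then have "\<alpha> = (1 - real m + real n) / (2 * real n - real m)"
    using lin by (simp add: field_simps)
  then have \<alpha>: "\<alpha> \<in> \<rat>" by simp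
  have q: "\<alpha>\<^sup>2 - \<alpha> = real lam / N" using quad[OF i] by (simp add: \<alpha>_def)
  \<comment> \<open>As \<open>lam > 0\<close>, the quadratic determines \<open>N\<close> as a
    rational expression in \<open>\<alpha>\<close>.\<close>
  have "N = real lam / (real lam / N)" using N(1) assms(2) by simp
  then have "N = real lam / (\<alpha>\<^sup>2 - \<alpha>)" by (simp only: q)
  then have "N \<in> \<rat>" using \<alpha> by (metis Rats_diff Rats_divide Rats_of_nat Rats_power)
  then have "(a i)\<^sup>2 * N \<in> \<rat>" using \<alpha> by (simp add: \<alpha>_def)
  then obtain p q where "(a i)\<^sup>2 * N = real_of_int p / real_of_int q"
    unfolding Rats_eq_int_div_int by blast
  then have "X i * cnj (X i) = of_int p / of_int q"
    using norm[OF i] by (simp only: of_real_divide of_real_of_int_eq)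
  then show ?thesis by simp
qed

section \<open>Character sums over the group and its subsets\<close>

context comm_group
begin

lemma character_norm:
  assumes "partial_character (carrier G) f" "finite (carrier G)" "x \<in> carrier G"
  shows "f x * cnj (f x) = 1"
proof -
  have n: "ord x > 0" using ord_ge_1[OF assms(2,3)] by simp
  have "f x ^ ord x = 1"
    using partial_character_pow[OF assms(1,3), of "ord x"] assms(1,3)
    by (simp add: partial_character_def)
  then have "cmod (f x) = 1" using n
    by (metis norm_one norm_power power_eq_1_iff norm_ge_zero less_not_refl)
  then show ?thesis by (simp add: complex_norm_square[symmetric])
qed

lemma character_inv:
  assumes f: "partial_character (carrier G) f" "finite (carrier G)" "x \<in> carrier G"
  shows "f (inv x) = cnj (f x)"
proof -
  have "f (inv x) * f x = 1"
    using f by (metis (no_types, lifting) inv_closed l_inv partial_character_def)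
  then have "f (inv x) * (f x * cnj (f x)) = cnj (f x)" by (simp flip: mult.assoc)
  then show ?thesis using character_norm[OF f] by simp
qed

lemma sum_character_eq_0:
  assumes f: "partial_character (carrier G) f" and g: "g \<in> carrier G" "f g \<noteq> 1"
  shows "(\<Sum>x\<in>carrier G. f x) = 0"
proof -
  have "(\<Sum>x\<in>carrier G. f x) = (\<Sum>x\<in>carrier G. f (g \<otimes> x))"
  proof (rule sum.reindex_bij_betw[symmetric])
    show "bij_betw (\<lambda>x. g \<otimes> x) (carrier G) (carrier G)"
      using g by (intro bij_betwI[where g = "\<lambda>x. inv g \<otimes> x"]) (auto simp flip: m_assoc)
  qed
  also have "\<dots> = f g * (\<Sum>x\<in>carrier G. f x)"
    using f g unfolding sum_distrib_left by (intro sum.cong) (auto simp: partial_character_def)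
  finally have "(1 - f g) * (\<Sum>x\<in>carrier G. f x) = 0" by (simp add: algebra_simps)
  then show ?thesis using g(2) by simp
qed

text \<open>The left side is the sum of \<open>f\<close> over the multiset of differences. Each
  non-identity element occurs \<open>lam\<close> times; since \<open>f\<close> sums to 0 over the
  group, the missing identity accounts for \<open>- lam\<close>.\<close>

lemma SEDF_character_equation:
  assumes fin: "finite (carrier G)" and D: "is_SEDF G v m k lam D"
    and f: "partial_character (carrier G) f" and g: "g \<in> carrier G" "f g \<noteq> 1"
    and j: "j \<in> {1..m}"
  shows "((\<Sum>l\<in>{1..m}. sum f (D l)) - sum f (D j)) * cnj (sum f (D j)) = - of_nat lam"
proof -
  have sub: "D l \<subseteq> carrier G" if "l \<in> {1..m}" for l using D that by (simp add: is_SEDF_def)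
  have finD: "finite (D l)" if "l \<in> {1..m}" for l using sub[OF that] fin finite_subset by blast
  let ?T = "{(l, x, y). l \<in> {1..m} \<and> l \<noteq> j \<and> x \<in> D l \<and> y \<in> D j}"
  have T: "?T = (SIGMA l:{1..m} - {j}. D l \<times> D j)" by auto
  have finT: "finite ?T" unfolding T using finD j by (intro finite_SigmaI) auto
  let ?M = "ext_differences G m D j"
  have setM: "set_mset ?M \<subseteq> carrier G"
    using finT sub j by (fastforce simp: ext_differences_def)
  have "((\<Sum>l\<in>{1..m}. sum f (D l)) - sum f (D j)) * cnj (sum f (D j))
      = (\<Sum>l\<in>{1..m} - {j}. sum f (D l)) * cnj (sum f (D j))"
    using j by (simp add: sum_diff1)
  also have "\<dots> = (\<Sum>l\<in>{1..m} - {j}. \<Sum>x\<in>D l. \<Sum>y\<in>D j. f x * cnj (f y))"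
    by (simp only: sum_distrib_right) (simp only: cnj_sum sum_distrib_left)
  also have "\<dots> = (\<Sum>l\<in>{1..m} - {j}. \<Sum>x\<in>D l. \<Sum>y\<in>D j. f (x \<otimes> inv y))"
  proof (intro sum.cong refl)
    fix l x y assume *: "l \<in> {1..m} - {j}" "x \<in> D l" "y \<in> D j"
    then have "x \<in> carrier G" "y \<in> carrier G" using sub j by blast+
    then show "f x * cnj (f y) = f (x \<otimes> inv y)"
      using f character_inv[OF f fin] by (simp add: partial_character_def)
  qed
  also have "\<dots> = (\<Sum>(l, x, y)\<in>?T. f (x \<otimes> inv y))"
    unfolding T using finD j by (subst sum.Sigma[symmetric]) (auto simp: sum.cartesian_product)
  also have "\<dots> = (\<Sum>x\<in>#?M. f x)"
    by (simp add: ext_differences_def sum_unfold_sum_mset multiset.map_comp comp_def case_prod_unfold)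
  also have "\<dots> = (\<Sum>x\<in>carrier G. of_nat (count ?M x) * f x)"
    using fin setM by (rule sum_mset_eq_sum_count)
  also have "\<dots> = (\<Sum>x\<in>carrier G. of_nat lam * f x - (if x = \<one> then of_nat lam else 0))"
  proof (intro sum.cong refl)
    fix x assume "x \<in> carrier G"
    then have "count ?M x = (if x = \<one> then 0 else lam)"
      using D j by (auto simp: is_SEDF_def not_in_iff)
    then show "of_nat (count ?M x) * f x = of_nat lam * f x - (if x = \<one> then of_nat lam else 0)"
      using f by (simp add: partial_character_def)
  qed
  also have "\<dots> = - of_nat lam"
    using sum_character_eq_0[OF f g] fin by (simp add: sum_subtractf flip: sum_distrib_left)
  finally show ?thesis .
qed

text \<open>Multiplication by a power of \<open>g\<close> carries the kernel onto each fibre, so the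
  \<open>d\<close> fibres, which partition the group, have equal size.\<close>

lemma card_character_fiber:
  assumes fin: "finite (carrier G)" and f: "partial_character (carrier G) f"
    and d: "d > 0" and z: "z = cis (2 * pi / real d)"
    and fd: "\<And>x. x \<in> carrier G \<Longrightarrow> f x ^ d = 1"
    and g: "g \<in> carrier G" "f g = z"
  shows "d * card {x \<in> carrier G. f x = z ^ k} = card (carrier G)"
proof -
  have eq: "card {x \<in> carrier G. f x = z ^ k} = card {x \<in> carrier G. f x = 1}" for k
  proof (rule bij_betw_same_card[symmetric])
    have gk: "g [^] k \<in> carrier G" "f (g [^] k) = z ^ k"
      using partial_character_pow[OF f g(1), of k] g by simp_all
    show "bij_betw (\<lambda>x. g [^] k \<otimes> x) {x \<in> carrier G. f x = 1} {x \<in> carrier G. f x = z ^ k}"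
    proof (rule bij_betwI[where g = "\<lambda>x. inv (g [^] k) \<otimes> x"])
      show "(\<lambda>x. g [^] k \<otimes> x) \<in> {x \<in> carrier G. f x = 1} \<rightarrow> {x \<in> carrier G. f x = z ^ k}"
        using f gk by (auto simp: partial_character_def)
      show "(\<lambda>x. inv (g [^] k) \<otimes> x) \<in> {x \<in> carrier G. f x = z ^ k} \<rightarrow> {x \<in> carrier G. f x = 1}"
      proof safe
        fix x assume x: "x \<in> carrier G" "f x = z ^ k"
        then have "f (inv (g [^] k) \<otimes> x) = cnj (f (g [^] k)) * f x"
          using f gk character_inv[OF f fin gk(1)] by (simp add: partial_character_def)
        then show "f (inv (g [^] k) \<otimes> x) = 1"
          using x gk character_norm[OF f fin gk(1)] by (simp add: mult.commute)
      qed (use gk in simp)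
    qed (use gk in \<open>simp_all flip: m_assoc\<close>)
  qed
  have inj: "inj_on (\<lambda>k. z ^ k) {..<d}"
    using cis_power_eq_iff[OF d] z by (auto simp: inj_on_def)
  have "carrier G = (\<Union>k<d. {x \<in> carrier G. f x = z ^ k})"
  proof -
    have "\<exists>k<d. f x = z ^ k" if "x \<in> carrier G" for x
      unfolding z using d fd[OF that] by (rule root_of_unity_eq_cis_power)
    then show ?thesis by auto
  qed
  then have "card (carrier G) = card (\<Union>k<d. {x \<in> carrier G. f x = z ^ k})" by simp
  also have "\<dots> = (\<Sum>k<d. card {x \<in> carrier G. f x = z ^ k})"
    using fin inj by (intro card_UN_disjoint) (auto simp: inj_on_def)
  also have "\<dots> = d * card {x \<in> carrier G. f x = z ^ k}" by (simp add: eq)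
  finally show ?thesis by simp
qed

text \<open>Counting the elements of \<open>A\<close> in the fibres of \<open>f\<close> gives a
  function with values between 0 and the fibre size, whose transform at \<open>z\<close> is the
  character sum over \<open>A\<close>.\<close>

lemma character_sum_dvd_bound:
  assumes fin: "finite (carrier G)" and f: "partial_character (carrier G) f"
    and d: "d > 1" and z: "z = cis (2 * pi / real d)"
    and fd: "\<And>x. x \<in> carrier G \<Longrightarrow> f x ^ d = 1"
    and g: "g \<in> carrier G" "f g = z"
    and A: "A \<subseteq> carrier G" "sum f A \<noteq> 0"
    and c: "sum f A = of_nat c * y" "y \<in> int_adjoin z" "coprime c d"
  shows "real c \<le> 2 ^ (card (prime_factors d) - 1) * (real (card (carrier G)) / real d)"
proof -
  have d0: "d > 0" using d by simp
  define B where "B = card {x \<in> carrier G. f x = 1}"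
  have B: "d * B = card (carrier G)" "card {x \<in> carrier G. f x = z ^ k} = B" for k
  proof -
    show "d * B = card (carrier G)"
      using card_character_fiber[OF fin f d0 z fd g, of 0] by (simp add: B_def)
    then have "d * card {x \<in> carrier G. f x = z ^ k} = d * B"
      using card_character_fiber[OF fin f d0 z fd g, of k] by simp
    then show "card {x \<in> carrier G. f x = z ^ k} = B" using d0 by (simp only: mult_cancel1) simp
  qed
  have finA: "finite A" using A(1) fin finite_subset by blast
  define h where "h k = int (card {x \<in> A. f x = z ^ nat (k mod int d)})" for k
  have per: "periodic d h" by (simp add: periodic_def h_def)
  have "h k \<le> int B" for k
  proof -
    have "card {x \<in> A. f x = z ^ nat (k mod int d)} \<le> card {x \<in> carrier G. f x = z ^ nat (k mod int d)}"
      using A(1) fin by (intro card_mono) auto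
    then show ?thesis using B by (simp add: h_def)
  qed
  moreover have four: "fourier d h z = sum f A"
  proof -
    have "\<exists>k<d. f x = z ^ k" if "x \<in> A" for x
      unfolding z using d0 fd[OF subsetD[OF A(1) that]] by (rule root_of_unity_eq_cis_power)
    then have un: "A = (\<Union>k<d. {x \<in> A. f x = z ^ k})" by auto
    have "sum f A = sum f (\<Union>k<d. {x \<in> A. f x = z ^ k})" using un by simp
    also have "\<dots> = (\<Sum>k<d. sum f {x \<in> A. f x = z ^ k})"
      using finA cis_power_eq_iff[OF d0] z by (intro sum.UNION_disjoint) auto
    also have "\<dots> = (\<Sum>k<d. of_nat (card {x \<in> A. f x = z ^ k}) * z ^ k)"
      by (intro sum.cong) auto
    also have "\<dots> = fourier d h z"
      unfolding fourier_def by (intro sum.cong) (simp_all add: h_def)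
    finally show ?thesis by simp
  qed
  ultimately have "int c \<le> 2 ^ (card (prime_factors d) - 1) * int B"
    using root_of_unity_sum_bound[OF d per _ _ z, of "int B" c y] A(2) c by (simp add: h_def)
  then have "real_of_int (int c) \<le> real_of_int (2 ^ (card (prime_factors d) - 1) * int B)"
    by (simp only: of_int_le_iff)
  moreover have "real B = real (card (carrier G)) / real d"
    using d0 by (simp flip: B(1))
  ultimately show ?thesis by simp
qed

end

theorem theorem3p16:
  fixes G :: "('a, 'b) monoid_scheme"
    and v m k lam d t lam' :: nat
  assumes "comm_group G"
    and "finite (carrier G)"
    and "Coset.order G = v"
    and "\<exists>D. is_SEDF G v m k lam D"
    and "m \<ge> 3"
    and "d > 2"
    and "d dvd group_exponent G"
    and "t = card (prime_factors d)"
    and "lam' dvd lam"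
    and "self_conjugate lam' d"
    and "coprime lam' d"
  shows "\<exists>c::nat. c dvd lam' \<and> sqrt (real lam') \<le> real c \<and>
           real c \<le> 2 ^ (t - 1) * (real v / real d)"
proof -
  interpret comm_group G by (rule assms(1))
  note fin = assms(2)
  obtain D where D: "is_SEDF G v m k lam D" using assms(4) by blast
  have d0: "d > 0" using assms(6) by simp
  have lam0: "lam > 0" using D by (simp add: is_SEDF_def)
  have lam'0: "lam' > 0" using lam0 assms(9) by (auto intro: gr0I)
  define z where "z = cis (2 * pi / real d)"
  have zd: "z ^ d = 1" using d0 by (simp add: z_def DeMoivre)
  obtain f g where f: "partial_character (carrier G) f" and fd: "\<And>x. x \<in> carrier G \<Longrightarrow> f x ^ d = 1"
    and g: "g \<in> carrier G" "f g = z"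
    using ex_character_onto_roots_of_unity[OF fin assms(7)] by (auto simp: z_def)
  have g1: "f g \<noteq> 1"
    using cis_power_eq_1_iff[OF d0, of 1] assms(6) g(2) by (simp add: z_def)
  have adjoin: "sum f A \<in> int_adjoin z" if A: "A \<subseteq> carrier G" for A
  proof (rule int_adjoin_sum)
    fix a assume "a \<in> A"
    then obtain i where "f a = z ^ i"
      using root_of_unity_eq_cis_power[OF d0 fd] A unfolding z_def by blast
    then show "f a \<in> int_adjoin z" by simp
  qed
  define S where "S = (\<Sum>l\<in>{1..m}. sum f (D l))"
  have eq: "(S - sum f (D j)) * cnj (sum f (D j)) = - of_nat lam" if "j \<in> {1..m}" for j
    unfolding S_def using SEDF_character_equation[OF fin D f g(1) g1 that] .
  have one: "1 \<in> {1..m}" using assms(5) by simp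
  have sub: "D l \<subseteq> carrier G" if "l \<in> {1..m}" for l using D that by (simp add: is_SEDF_def)
  \<comment> \<open>With the other blocks merged, \<open>?y\<close> is again a character sum over a
    subset of the group, so the same bound applies to it.\<close>
  define B where "B = (\<Union>l\<in>{1..m} - {1}. D l)"
  have B: "B \<subseteq> carrier G" using sub unfolding B_def by blast
  have sumB: "sum f B = S - sum f (D 1)"
  proof -
    have "sum f B = (\<Sum>l\<in>{1..m} - {1}. sum f (D l))"
      unfolding B_def
    proof (rule sum.UNION_disjoint)
      show "\<forall>l\<in>{1..m} - {1}. finite (D l)" using sub fin finite_subset by blast
      show "\<forall>i\<in>{1..m} - {1}. \<forall>j\<in>{1..m} - {1}. i \<noteq> j \<longrightarrow> D i \<inter> D j = {}"
        using D by (auto simp: is_SEDF_def)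
    qed simp
    also have "\<dots> = S - sum f (D 1)" unfolding S_def using one by (simp add: sum_diff1)
    finally show ?thesis .
  qed
  let ?x = "sum f (D 1)" and ?y = "sum f B"
  have x: "?x \<in> int_adjoin z" and y: "?y \<in> int_adjoin z" using adjoin sub[OF one] B by blast+
  have xy: "cnj ?x * ?y = of_int (- int lam)"
    using eq[OF one] by (simp add: sumB mult.commute)
  have "cnj ?x * ?y \<noteq> 0" unfolding xy using lam0 by simp
  then have nz: "?x \<noteq> 0" "?y \<noteq> 0" by (metis complex_cnj_zero mult_zero_left mult_zero_right)+
  have cnj_x: "cnj ?x \<in> int_adjoin z" and cnj_y: "cnj ?y \<in> int_adjoin z"
    using int_adjoin_cnj[OF zd d0] x y by blast+
  have xx: "?x * cnj ?x \<in> \<rat>"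
    using rational_norm_of_difference_equations[OF assms(5) lam0 S_def eq one] .
  \<comment> \<open>The squared norms multiply to \<open>lam * lam\<close>, so rationality of the
    first implies that of the second.\<close>
  have "(?x * cnj ?x) * (?y * cnj ?y) = (cnj ?x * ?y) * cnj (cnj ?x * ?y)"
    by (simp only: complex_cnj_mult complex_cnj_cnj mult_ac)
  also have "\<dots> = of_nat (lam * lam)" unfolding xy by simp
  finally have "(?x * cnj ?x) * (?y * cnj ?y) = of_nat (lam * lam)" .
  moreover have "?x * cnj ?x \<noteq> 0"
    using nz(1) by (simp only: mult_eq_0_iff complex_cnj_zero_iff simp_thms not_False_eq_True)
  ultimately have "?y * cnj ?y = of_nat (lam * lam) / (?x * cnj ?x)"
    by (metis nonzero_mult_div_cancel_left)
  then have yy: "?y * cnj ?y \<in> \<rat>" using xx by (metis Rats_divide Rats_of_nat)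
  obtain a where a: "?x * cnj ?x = of_int a"
    using int_adjoin_rational[OF zd d0 int_adjoin_mult[OF x cnj_x] xx] by (auto elim: Ints_cases)
  obtain b where b: "?y * cnj ?y = of_int b"
    using int_adjoin_rational[OF zd d0 int_adjoin_mult[OF y cnj_y] yy] by (auto elim: Ints_cases)
  have sc: "self_conjugate_prime p d \<and> coprime p d" if "prime p" "p dvd lam'" for p
    using that assms(10,11) lam'0 coprime_divisors[OF that(2) dvd_refl, of d]
    by (auto simp: self_conjugate_def in_prime_factors_iff)
  have lz: "- int lam \<noteq> 0" "int lam' dvd - int lam" using lam0 assms(9) by auto
  obtain c1 c2 x' y' where c: "lam' = c1 * c2" and x': "x' \<in> int_adjoin z" "?x = of_nat c1 * x'"
    and y': "y' \<in> int_adjoin z" "?y = of_nat c2 * y'"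
    using self_conjugate_factorization[OF zd assms(6) lam'0 sc x y xy lz a b] by blast
  have cop: "coprime c1 d" "coprime c2 d" using assms(11) c by simp_all
  have d1: "d > 1" using assms(6) by simp
  have v: "card (carrier G) = v" using assms(3) by (simp add: Coset.order_def)
  have bound1: "real c1 \<le> 2 ^ (t - 1) * (real v / real d)"
    using character_sum_dvd_bound[OF fin f d1 z_def fd g sub[OF one] nz(1) x'(2,1) cop(1)]
    by (simp add: v assms(8))
  have bound2: "real c2 \<le> 2 ^ (t - 1) * (real v / real d)"
    using character_sum_dvd_bound[OF fin f d1 z_def fd g B nz(2) y'(2,1) cop(2)]
    by (simp add: v assms(8))
  have sqrt: "sqrt (real lam') \<le> real (max c1 c2)"
  proof (rule real_le_lsqrt)
    have "c1 * c2 \<le> max c1 c2 * max c1 c2" by (intro mult_le_mono) auto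
    then show "real lam' \<le> (real (max c1 c2))\<^sup>2"
      unfolding c power2_eq_square by (simp only: of_nat_mult[symmetric] of_nat_le_iff)
  qed simp_all
  show ?thesis
    using sqrt bound1 bound2 c by (intro exI[of _ "max c1 c2"]) (auto simp: max_def)
qed

end
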